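(* Let $A \subseteq \mathcal{N}$ be a (lightface) $\Delta^1_1$ set. Then exactly one of the following two claims holds: (I) $A$ is equal to the union $U$ of all sets of the form $[T]$, where $T \subseteq \mathbb{N}^{<\omega}$ is a compact $\Delta^1_1$ tree with $[T]\subseteq A$; and moreover there is a $\Delta^1_1$ sequence $\{T_n\}_{n\in\mathbb{N}}$ of compact trees $T_n \subseteq \mathbb{N}^{<\omega}$ such that $A = \bigcup_n [T_n]$; (II) there is a set $Y \subseteq A$ which is homeomorphic to $\mathcal{N}$ and relatively closed in $A$.
   Context: $\mathcal{N} = \mathbb{N}^{\mathbb{N}}$ is the Baire space with its product topology; $\Sigma^1_1$, $\Pi^1_1$, $\Delta^1_1$ denote the lightface (effective) pointclasses, with subsets of the countable set $\mathbb{N}^{<\omega}$ and sequences of such subsets coded as elements of the appropriate Polish spaces in the standard way. A set $T \subseteq \mathbb{N}^{<\omega}$ is a tree if it is closed under initial segments; it is pruned if every $s\in T$ has some extension $s^\frown n \in T$; it is compact if it is pruned and for every $s\in T$ there are only finitely many $n$ with $s^\frown n\in T$. For a tree $T$, $[T] = \{x\in\mathcal{N} : \forall m\, (x\restriction m \in T)\}$. *)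

theory Defs
  imports "HOL-Analysis.Analysis" "HOL-Library.Nat_Bijection" "HOL-Library.Sublist"
begin

datatype recf =
    Zero
  | Succ
  | Proj nat
  | Comp recf "recf list"
  | PRec recf recf
  | Mu recf

text \<open>\<open>eval f xs y\<close>: the computation of \<open>f\<close> on input \<open>xs\<close> converges with value \<open>y\<close>. Terms carry no
  arity; the \<open>k\<close>-ary partial recursive functions are obtained by feeding lists of length \<open>k\<close>.
  In \<open>PRec\<close> the recursion variable, and in \<open>Mu\<close> the search variable, is the head of the input;
  \<open>Mu\<close> requires convergence at all smaller arguments.\<close>

inductive eval :: "recf \<Rightarrow> nat list \<Rightarrow> nat \<Rightarrow> bool" where
  eval_Zero: "eval Zero xs 0"
| eval_Succ: "eval Succ [x] (Suc x)"
| eval_Proj: "i < length xs \<Longrightarrow> eval (Proj i) xs (xs ! i)"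
| eval_Comp: "list_all2 (\<lambda>g y. eval g xs y) gs ys \<Longrightarrow> eval f ys z \<Longrightarrow> eval (Comp f gs) xs z"
| eval_PRec_0: "eval f xs y \<Longrightarrow> eval (PRec f g) (0 # xs) y"
| eval_PRec_Suc: "eval (PRec f g) (n # xs) r \<Longrightarrow> eval g (n # r # xs) y \<Longrightarrow>
    eval (PRec f g) (Suc n # xs) y"
| eval_Mu: "eval f (n # xs) 0 \<Longrightarrow> \<forall>m<n. \<exists>y>0. eval f (m # xs) y \<Longrightarrow> eval (Mu f) xs n"

definition re_domain :: "recf \<Rightarrow> nat list set" where
  "re_domain f = {xs. \<exists>y. eval f xs y}"

type_synonym baire = "nat \<Rightarrow> nat"

definition restr :: "baire \<Rightarrow> nat \<Rightarrow> nat list" where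
  "restr x m = map x [0..<m]"

text \<open>A subset of the product of \<open>k\<close> copies of \<open>nat\<close> and \<open>l\<close> copies of \<open>baire\<close> is given by a
  predicate \<open>P as xs\<close>, of which only the values with \<open>length as = k\<close> and \<open>length xs = l\<close> matter.
  A pair of lists \<open>as\<close>, \<open>ss\<close> determines the basic neighbourhood of all points \<open>(as, xs)\<close> such that
  every \<open>xs ! i\<close> extends the finite sequence \<open>ss ! i\<close>. The effectively open sets are the unions of
  recursively enumerable families of basic neighbourhoods; \<open>list_encode\<close> is a recursive bijection
  between finite sequences and \<open>nat\<close>.\<close>

definition sigma01 :: "nat \<Rightarrow> nat \<Rightarrow> (nat list \<Rightarrow> baire list \<Rightarrow> bool) \<Rightarrow> bool" where
  "sigma01 k l P \<longleftrightarrow> (\<exists>f. \<forall>as xs. length as = k \<longrightarrow> length xs = l \<longrightarrow>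
     (P as xs \<longleftrightarrow>
       (\<exists>ss. as @ map list_encode ss \<in> re_domain f \<and>
             list_all2 (\<lambda>x s. restr x (length s) = s) xs ss)))"

definition pi01 :: "nat \<Rightarrow> nat \<Rightarrow> (nat list \<Rightarrow> baire list \<Rightarrow> bool) \<Rightarrow> bool" where
  "pi01 k l P \<longleftrightarrow> sigma01 k l (\<lambda>as xs. \<not> P as xs)"

definition sigma11 :: "nat \<Rightarrow> nat \<Rightarrow> (nat list \<Rightarrow> baire list \<Rightarrow> bool) \<Rightarrow> bool" where
  "sigma11 k l P \<longleftrightarrow> (\<exists>Q. pi01 k (Suc l) Q \<and>
     (\<forall>as xs. length as = k \<longrightarrow> length xs = l \<longrightarrow> (P as xs \<longleftrightarrow> (\<exists>y. Q as (y # xs)))))"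

definition pi11 :: "nat \<Rightarrow> nat \<Rightarrow> (nat list \<Rightarrow> baire list \<Rightarrow> bool) \<Rightarrow> bool" where
  "pi11 k l P \<longleftrightarrow> sigma11 k l (\<lambda>as xs. \<not> P as xs)"

definition delta11 :: "nat \<Rightarrow> nat \<Rightarrow> (nat list \<Rightarrow> baire list \<Rightarrow> bool) \<Rightarrow> bool" where
  "delta11 k l P \<longleftrightarrow> sigma11 k l P \<and> pi11 k l P"

definition delta11_set :: "baire set \<Rightarrow> bool" where
  "delta11_set A \<longleftrightarrow> delta11 0 1 (\<lambda>_ xs. xs ! 0 \<in> A)"

text \<open>A point of Baire space is \<open>\<Delta>\<^sup>1\<^sub>1\<close> if its graph is.\<close>

definition delta11_point :: "baire \<Rightarrow> bool" where
  "delta11_point x \<longleftrightarrow> delta11 2 0 (\<lambda>as _. x (as ! 0) = as ! 1)"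

text \<open>Sets of finite sequences, and sequences of such sets, are coded by the characteristic
  functions of the corresponding subsets of \<open>nat\<close>.\<close>

definition set_code :: "nat list set \<Rightarrow> baire" where
  "set_code T = (\<lambda>c. if list_decode c \<in> T then 1 else 0)"

definition set_seq_code :: "(nat \<Rightarrow> nat list set) \<Rightarrow> baire" where
  "set_seq_code Ts = (\<lambda>c. case prod_decode c of (n, d) \<Rightarrow> set_code (Ts n) d)"

text \<open>The empty set counts as a tree, and is a compact tree with empty body.\<close>

definition is_tree :: "nat list set \<Rightarrow> bool" where
  "is_tree T \<longleftrightarrow> (\<forall>t\<in>T. \<forall>s. prefix s t \<longrightarrow> s \<in> T)"

definition pruned :: "nat list set \<Rightarrow> bool" where
  "pruned T \<longleftrightarrow> (\<forall>s\<in>T. \<exists>n. s @ [n] \<in> T)"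

definition compact_tree :: "nat list set \<Rightarrow> bool" where
  "compact_tree T \<longleftrightarrow> is_tree T \<and> pruned T \<and> (\<forall>s\<in>T. finite {n. s @ [n] \<in> T})"

definition body :: "nat list set \<Rightarrow> baire set" where
  "body T = {x. \<forall>m. restr x m \<in> T}"

end

theory Submission
  imports Defs
begin

text \<open>Write \<open>A\<close> and its complement as projections of \<open>\<Delta>\<^sup>1\<^sub>1\<close> trees \<open>S\<close> and \<open>T\<close>. In an open game on
  natural numbers the second player keeps extending a node of \<open>S\<close> while exhibiting limit points of
  the projection that lie outside \<open>A\<close>, in a compactification of Baire space. If the first player
  cannot win, the second player's answers form a scheme whose branches make up a relatively closed
  copy of Baire space in \<open>A\<close>. If the first player wins, let \<open>T\<^sub>u\<close>, for a node \<open>u\<close> of \<open>S\<close> which is won, be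
  the tree of all sequences extendible to nodes above \<open>u\<close> that are not won at an earlier stage
  than \<open>u\<close>. The winning move at \<open>u\<close> shows that \<open>T\<^sub>u\<close> is finitely branching with \<open>[T\<^sub>u] \<subseteq> A\<close>, and these
  bodies cover \<open>A\<close>, since each branch of \<open>S\<close> contains a node which is won at a minimal stage.
  Comparison of stages is the unique solution of an arithmetical recursion, hence \<open>\<Delta>\<^sup>1\<^sub>1\<close>, as long as
  one of the two positions is won; so no ordinals and no codes for \<open>\<Delta>\<^sup>1\<^sub>1\<close> sets are needed.\<close>


section \<open>Recursive functions\<close>

\<comment> \<open>The compactification consists of all finite and infinite sequences, where a finite
  \<open>r\<close> is the limit of points through \<open>r @ [n]\<close> as \<open>n\<close> grows.
  The closure of a set of points in it stays inside \<open>A\<close> exactly if the tree of their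
  initial segments is finitely branching and has all branches in \<open>A\<close>. Hence the two
  kinds of limits that the second player may announce, and hence the compactness of
  \<open>T\<^sub>u\<close>. The obstacle is that a solution of the comparison recursion may be
  arbitrary on pairs of positions neither of which is won. If the root is won, comparison with the
  root gets around this: trees are kept only for nodes won no later than the root, a test on which
  all solutions agree. No point is lost, since a minimal stage along a branch of \<open>S\<close> is
  at most that of the root. The two claims exclude each other by diagonalisation: on the
  \<open>n\<close>-th of countably many compact sets the \<open>n\<close>-th coordinate of a copy of
  Baire space is bounded.\<close>
inductive_simps eval_Zero_iff [simp]: "eval Zero xs y"
inductive_simps eval_Succ_iff: "eval Succ xs y"
inductive_simps eval_Succ1_iff [simp]: "eval Succ [x] y"
inductive_simps eval_Proj_iff [simp]: "eval (Proj i) xs y"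
inductive_simps eval_Comp_iff: "eval (Comp f gs) xs y"
inductive_simps eval_PRec_0_iff [simp]: "eval (PRec f g) (0 # xs) y"
inductive_simps eval_PRec_Suc_iff [simp]: "eval (PRec f g) (Suc n # xs) y"
inductive_simps eval_PRec_Nil_iff [simp]: "eval (PRec f g) [] y"
inductive_simps eval_Mu_iff: "eval (Mu f) xs y"

text \<open>The equivalence also excludes every other value, so determinism of \<open>eval\<close>
  never has to be proved separately.\<close>

definition computable :: "nat \<Rightarrow> (nat list \<Rightarrow> nat) \<Rightarrow> bool" where
  "computable k h \<longleftrightarrow> (\<exists>f. \<forall>xs. length xs = k \<longrightarrow> (\<forall>y. eval f xs y \<longleftrightarrow> y = h xs))"

lemma rcE:
  assumes "computable k h"
  obtains f where "\<And>xs y. length xs = k \<Longrightarrow> eval f xs y \<longleftrightarrow> y = h xs"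
  using assms unfolding computable_def by blast

lemma rcI: "(\<And>xs y. length xs = k \<Longrightarrow> eval f xs y \<longleftrightarrow> y = h xs) \<Longrightarrow> computable k h"
  unfolding computable_def by blast

lemma computable_cong: "computable k h \<Longrightarrow> (\<And>xs. length xs = k \<Longrightarrow> h xs = h' xs) \<Longrightarrow> computable k h'"
  unfolding computable_def by (metis (no_types, lifting))

lemma list_all2_computable:
  assumes "\<forall>h\<in>set hs. computable k h"
  obtains gs where
    "\<And>xs ys. length xs = k \<Longrightarrow> list_all2 (\<lambda>g y. eval g xs y) gs ys \<longleftrightarrow> ys = map (\<lambda>h. h xs) hs"
  using assms
proof (induction hs arbitrary: thesis)
  case Nil
  show ?case by (rule Nil(1)[of "[]"]) simp
next
  case (Cons h hs)
  from Cons(3) obtain g where g: "\<And>xs y. length xs = k \<Longrightarrow> eval g xs y \<longleftrightarrow> y = h xs"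
    by (metis list.set_intros(1) rcE)
  from Cons(1,3) obtain gs where gs:
    "\<And>xs ys. length xs = k \<Longrightarrow> list_all2 (\<lambda>g y. eval g xs y) gs ys \<longleftrightarrow> ys = map (\<lambda>h. h xs) hs"
    by auto
  show ?case by (rule Cons(2)[of "g # gs"]) (auto simp: list_all2_Cons1 g gs)
qed

lemma computable_comp:
  assumes "computable (length hs) h" "\<forall>h\<in>set hs. computable k h"
  shows "computable k (\<lambda>xs. h (map (\<lambda>h. h xs) hs))"
proof -
  obtain gs where gs:
    "\<And>xs ys. length xs = k \<Longrightarrow> list_all2 (\<lambda>g y. eval g xs y) gs ys \<longleftrightarrow> ys = map (\<lambda>h. h xs) hs"
    using list_all2_computable[OF assms(2)] by blast
  obtain f where f: "\<And>xs y. length xs = length hs \<Longrightarrow> eval f xs y \<longleftrightarrow> y = h xs"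
    using assms(1) unfolding computable_def by blast
  show ?thesis
    by (rule rcI[of _ "Comp f gs"]) (simp add: eval_Comp_iff gs f)
qed

lemma computable_0: "computable k (\<lambda>_. 0)"
  by (rule rcI[of _ Zero]) auto

lemma computable_nth: "i < k \<Longrightarrow> computable k (\<lambda>xs. xs ! i)"
  by (rule rcI[of _ "Proj i"]) auto

definition computable1 :: "(nat \<Rightarrow> nat) \<Rightarrow> bool" where
  "computable1 h \<longleftrightarrow> computable 1 (\<lambda>xs. h (xs ! 0))"

definition computable2 :: "(nat \<Rightarrow> nat \<Rightarrow> nat) \<Rightarrow> bool" where
  "computable2 h \<longleftrightarrow> computable 2 (\<lambda>xs. h (xs ! 0) (xs ! 1))"

lemma computable_comp1: "computable1 h \<Longrightarrow> computable k s \<Longrightarrow> computable k (\<lambda>xs. h (s xs))"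
  using computable_comp[of "[s]" "\<lambda>xs. h (xs ! 0)" k] by (simp add: computable1_def)

lemma computable_comp2: "computable2 h \<Longrightarrow> computable k s \<Longrightarrow> computable k t \<Longrightarrow> computable k (\<lambda>xs. h (s xs) (t xs))"
  using computable_comp[of "[s, t]" "\<lambda>xs. h (xs ! 0) (xs ! 1)" k] by (simp add: computable2_def numeral_2_eq_2)

lemma computable1_Suc: "computable1 Suc"
  unfolding computable1_def by (rule rcI[of _ Succ]) (auto simp: length_Suc_conv)

lemma computable_Suc: "computable k s \<Longrightarrow> computable k (\<lambda>xs. Suc (s xs))"
  by (rule computable_comp1[OF computable1_Suc])

lemma computable_const: "computable k (\<lambda>_. n)"
  by (induction n) (auto intro: computable_0 computable_Suc)

lemma computable_rec:
  assumes "computable k a" "computable (Suc (Suc k)) b"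
  shows "computable (Suc k) (\<lambda>xs. rec_nat (a (tl xs)) (\<lambda>n r. b (n # r # tl xs)) (hd xs))"
proof -
  obtain f where f: "\<And>xs y. length xs = k \<Longrightarrow> eval f xs y \<longleftrightarrow> y = a xs"
    using assms(1) unfolding computable_def by blast
  obtain g where g: "\<And>xs y. length xs = Suc (Suc k) \<Longrightarrow> eval g xs y \<longleftrightarrow> y = b xs"
    using assms(2) unfolding computable_def by blast
  have "eval (PRec f g) (n # xs) y \<longleftrightarrow> y = rec_nat (a xs) (\<lambda>n r. b (n # r # xs)) n"
    if "length xs = k" for n xs y
    using that by (induction n arbitrary: y) (simp_all add: f g)
  then show ?thesis
    by (intro rcI[of _ "PRec f g"]) (auto simp: length_Suc_conv)
qed

lemma computable_rec_nat:
  assumes "computable k a" "computable (Suc (Suc k)) b" "computable k t"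
    and eq: "\<And>xs. length xs = k \<Longrightarrow> h xs = rec_nat (a xs) (\<lambda>n r. b (n # r # xs)) (t xs)"
  shows "computable k h"
proof -
  let ?hs = "t # map (\<lambda>i xs. xs ! i) [0..<k]"
  have "computable k (\<lambda>xs. (\<lambda>xs. rec_nat (a (tl xs)) (\<lambda>n r. b (n # r # tl xs)) (hd xs)) (map (\<lambda>h. h xs) ?hs))"
    by (rule computable_comp) (use computable_rec[OF assms(1,2)] assms(3) in \<open>auto intro: computable_nth\<close>)
  then show ?thesis
    by (rule computable_cong) (auto simp: comp_def eq map_nth)
qed

lemma computable_Least:
  assumes "computable (Suc k) g" and ex: "\<And>xs. length xs = k \<Longrightarrow> \<exists>n. g (n # xs) = 0"
  shows "computable k (\<lambda>xs. LEAST n. g (n # xs) = 0)"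
proof -
  obtain f where f: "\<And>xs y. length xs = Suc k \<Longrightarrow> eval f xs y \<longleftrightarrow> y = g xs"
    using assms(1) unfolding computable_def by blast
  show ?thesis
  proof (rule rcI[of _ "Mu f"])
    fix xs :: "nat list" and y assume l: "length xs = k"
    have "eval (Mu f) xs y \<longleftrightarrow> g (y # xs) = 0 \<and> (\<forall>m<y. g (m # xs) > 0)"
      using l by (auto simp: eval_Mu_iff f)
    also have "\<dots> \<longleftrightarrow> y = (LEAST n. g (n # xs) = 0)"
    proof
      assume "g (y # xs) = 0 \<and> (\<forall>m<y. g (m # xs) > 0)"
      then show "y = (LEAST n. g (n # xs) = 0)"
        by (intro Least_equality[symmetric]) (auto simp: not_less[symmetric])
    next
      assume "y = (LEAST n. g (n # xs) = 0)"
      then show "g (y # xs) = 0 \<and> (\<forall>m<y. g (m # xs) > 0)"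
        using LeastI_ex[OF ex[OF l]] not_less_Least by blast
    qed
    finally show "eval (Mu f) xs y \<longleftrightarrow> y = (LEAST n. g (n # xs) = 0)" .
  qed
qed

section \<open>Arithmetic and the Cantor pairing\<close>

lemma computable2_plus: "computable2 (+)"
  unfolding computable2_def
proof (rule computable_rec_nat[where a = "\<lambda>xs. xs ! 1" and b = "\<lambda>xs. Suc (xs ! 1)" and t = "\<lambda>xs. xs ! 0"])
  fix xs :: "nat list"
  have "n + m = rec_nat m (\<lambda>n r. Suc r) n" for n m :: nat by (induction n) auto
  then show "xs ! 0 + xs ! 1 = rec_nat (xs ! 1) (\<lambda>n r. Suc ((n # r # xs) ! 1)) (xs ! 0)" by simp
qed (auto intro!: computable_Suc computable_nth)

lemma computable1_pred: "computable1 (\<lambda>n. n - 1)"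
  unfolding computable1_def
proof (rule computable_rec_nat[where a = "\<lambda>xs. 0" and b = "\<lambda>xs. xs ! 0" and t = "\<lambda>xs. xs ! 0"])
  fix xs :: "nat list"
  have "n - 1 = rec_nat 0 (\<lambda>n r. n) n" for n :: nat by (induction n) auto
  then show "xs ! 0 - 1 = rec_nat 0 (\<lambda>n r. (n # r # xs) ! 0) (xs ! 0)" by simp
qed (auto intro!: computable_0 computable_nth)

lemma computable2_minus: "computable2 (-)"
  unfolding computable2_def
proof (rule computable_rec_nat[where a = "\<lambda>xs. xs ! 0" and b = "\<lambda>xs. xs ! 1 - 1" and t = "\<lambda>xs. xs ! 1"])
  fix xs :: "nat list"
  have "n - m = rec_nat n (\<lambda>m r. r - 1) m" for n m :: nat by (induction m) auto
  from this[of "xs ! 0" "xs ! 1"] show "xs ! 0 - xs ! 1 = rec_nat (xs ! 0) (\<lambda>n r. (n # r # xs) ! 1 - 1) (xs ! 1)" by simp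
qed (auto intro!: computable_nth computable_comp1[OF computable1_pred, unfolded One_nat_def])

lemma computable1_triangle: "computable1 triangle"
  unfolding computable1_def
proof (rule computable_rec_nat[where a = "\<lambda>xs. 0" and b = "\<lambda>xs. xs ! 1 + Suc (xs ! 0)" and t = "\<lambda>xs. xs ! 0"])
  fix xs :: "nat list"
  have "triangle n = rec_nat 0 (\<lambda>n r. r + Suc n) n" for n by (induction n) auto
  then show "triangle (xs ! 0) = rec_nat 0 (\<lambda>n r. (n # r # xs) ! 1 + Suc ((n # r # xs) ! 0)) (xs ! 0)"
    by simp
qed (auto intro!: computable_0 computable_nth computable_comp2[OF computable2_plus] computable_Suc)

lemma triangle_mono: "m \<le> n \<Longrightarrow> triangle m \<le> triangle n"
  by (induction rule: dec_induct) auto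

lemma prod_encode_mono: "a \<le> a' \<Longrightarrow> b \<le> b' \<Longrightarrow> prod_encode (a, b) \<le> prod_encode (a', b')"
  using triangle_mono[of "a + b" "a' + b'"] by (simp add: prod_encode_def)

lemma computable2_prod_encode: "computable2 (\<lambda>m n. prod_encode (m, n))"
  unfolding computable2_def prod_encode_def
  by (auto intro!: computable_nth computable_comp2[OF computable2_plus] computable_comp1[OF computable1_triangle])

text \<open>The pairing is \<open>triangle (a + b) + a\<close>, so \<open>a + b\<close> is the least
  \<open>w\<close> with \<open>c < triangle (Suc w)\<close>; minimisation recovers it and with it
  both components.\<close>

definition psum :: "nat \<Rightarrow> nat" where
  "psum c = (LEAST w. Suc c - triangle (Suc w) = 0)"

lemma psum_prod_encode: "psum (prod_encode (a, b)) = a + b"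
  unfolding psum_def
proof (rule Least_equality)
  fix w assume w: "Suc (prod_encode (a, b)) - triangle (Suc w) = 0"
  show "a + b \<le> w"
  proof (rule ccontr)
    assume "\<not> a + b \<le> w"
    then have "triangle (Suc w) \<le> triangle (a + b)" by (intro triangle_mono) auto
    with w show False by (auto simp: prod_encode_def)
  qed
qed (simp add: prod_encode_def)

lemma fst_prod_decode: "fst (prod_decode c) = c - triangle (psum c)"
  and snd_prod_decode: "snd (prod_decode c) = psum c - fst (prod_decode c)"
proof -
  obtain a b where c: "c = prod_encode (a, b)"
    by (metis prod.exhaust prod_decode_inverse)
  show "fst (prod_decode c) = c - triangle (psum c)"
    unfolding c psum_prod_encode prod_encode_inverse by (simp add: prod_encode_def)
  show "snd (prod_decode c) = psum c - fst (prod_decode c)"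
    unfolding c psum_prod_encode prod_encode_inverse by simp
qed

lemma computable1_psum: "computable1 psum"
proof -
  have "computable 1 (\<lambda>xs. LEAST w. Suc ((w # xs) ! 1) - triangle (Suc ((w # xs) ! 0)) = 0)"
  proof (rule computable_Least[where g = "\<lambda>xs. Suc (xs ! 1) - triangle (Suc (xs ! 0))"])
    show "computable (Suc 1) (\<lambda>xs. Suc (xs ! 1) - triangle (Suc (xs ! 0)))"
      by (intro computable_comp2[OF computable2_minus] computable_comp1[OF computable1_triangle] computable_Suc computable_nth) auto
    fix xs :: "nat list"
    have "Suc m \<le> triangle (Suc m)" for m by (induction m) auto
    then show "\<exists>n. Suc ((n # xs) ! 1) - triangle (Suc ((n # xs) ! 0)) = 0"
      by (auto intro!: exI[of _ "xs ! 0"])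
  qed
  then show ?thesis
    unfolding computable1_def by (rule computable_cong) (simp add: psum_def)
qed

lemma computable1_fst: "computable1 (\<lambda>c. fst (prod_decode c))"
  unfolding computable1_def fst_prod_decode
  by (intro computable_comp2[OF computable2_minus] computable_comp1[OF computable1_triangle] computable_comp1[OF computable1_psum] computable_nth) auto

lemma computable1_snd: "computable1 (\<lambda>c. snd (prod_decode c))"
  unfolding computable1_def snd_prod_decode
  by (intro computable_comp2[OF computable2_minus] computable_comp1[OF computable1_fst] computable_comp1[OF computable1_psum] computable_nth) auto

section \<open>Operations on codes of finite sequences\<close>

definition tlc :: "nat \<Rightarrow> nat" where "tlc c = snd (prod_decode (c - 1))"
definition hdc :: "nat \<Rightarrow> nat" where "hdc c = fst (prod_decode (c - 1))"
definition dropc :: "nat \<Rightarrow> nat \<Rightarrow> nat" where "dropc n c = (tlc ^^ n) c"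
definition nthc :: "nat \<Rightarrow> nat \<Rightarrow> nat" where "nthc c n = hdc (dropc n c)"
text \<open>The empty sequence has code 0 and \<open>tlc 0 = 0\<close>, so dropping entries reaches
  0 exactly when the sequence is exhausted, and stays there.\<close>

definition lenc :: "nat \<Rightarrow> nat" where "lenc c = (LEAST n. dropc n c = 0)"

lemma tlc_encode [simp]: "tlc (list_encode xs) = list_encode (tl xs)"
proof (cases xs)
  case Nil
  have "prod_decode 0 = (0, 0)"
    using prod_encode_inverse[of "(0, 0)"] by (simp add: prod_encode_def)
  with Nil show ?thesis by (simp add: tlc_def)
qed (simp add: tlc_def)

lemma hdc_encode: "xs \<noteq> [] \<Longrightarrow> hdc (list_encode xs) = hd xs"
  by (cases xs) (simp_all add: hdc_def)

lemma dropc_encode [simp]: "dropc n (list_encode xs) = list_encode (drop n xs)"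
  by (induction n arbitrary: xs) (simp_all add: dropc_def drop_Suc tl_drop)

lemma nthc_encode [simp]: "n < length xs \<Longrightarrow> nthc (list_encode xs) n = xs ! n"
  by (simp add: nthc_def hdc_encode hd_drop_conv_nth)

lemma list_encode_eq_0 [simp]: "list_encode xs = 0 \<longleftrightarrow> xs = []"
  by (cases xs) auto

lemma lenc_encode [simp]: "lenc (list_encode xs) = length xs"
  unfolding lenc_def by (intro Least_equality) auto

lemma computable1_tlc: "computable1 tlc" and computable1_hdc: "computable1 hdc"
  unfolding computable1_def tlc_def hdc_def
  by (intro computable_comp1[OF computable1_fst] computable_comp1[OF computable1_snd] computable_comp1[OF computable1_pred] computable_nth, simp)+

lemma computable2_dropc: "computable2 dropc"
  unfolding computable2_def
proof (rule computable_rec_nat[where a = "\<lambda>xs. xs ! 1" and b = "\<lambda>xs. tlc (xs ! 1)" and t = "\<lambda>xs. xs ! 0"])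
  fix xs :: "nat list"
  have "dropc n c = rec_nat c (\<lambda>n r. tlc r) n" for n c by (induction n) (auto simp: dropc_def)
  then show "dropc (xs ! 0) (xs ! 1) = rec_nat (xs ! 1) (\<lambda>n r. tlc ((n # r # xs) ! 1)) (xs ! 0)"
    by simp
qed (auto intro!: computable_nth computable_comp1[OF computable1_tlc])

lemma computable2_nthc: "computable2 nthc"
  unfolding computable2_def nthc_def by (intro computable_comp1[OF computable1_hdc] computable_comp2[OF computable2_dropc] computable_nth) auto

lemma computable1_lenc: "computable1 lenc"
proof -
  have "computable 1 (\<lambda>xs. LEAST n. dropc ((n # xs) ! 0) ((n # xs) ! 1) = 0)"
  proof (rule computable_Least[where g = "\<lambda>xs. dropc (xs ! 0) (xs ! 1)"])
    show "computable (Suc 1) (\<lambda>xs. dropc (xs ! 0) (xs ! 1))" using computable2_dropc by (simp add: computable2_def numeral_2_eq_2)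
    fix xs :: "nat list"
    have "dropc (length (list_decode c)) c = 0" for c
      by (metis drop_all dropc_encode list_decode_inverse list_encode_eq_0 order_refl)
    then show "\<exists>n. dropc ((n # xs) ! 0) ((n # xs) ! 1) = 0" by auto
  qed
  then show ?thesis
    unfolding computable1_def by (rule computable_cong) (simp add: lenc_def)
qed

text \<open>An initial segment of one column of the sequence coded by \<open>c\<close>. Columns are
  indexed by a number \<open>p\<close> and a flag \<open>b\<close>; \<open>col\<close> is the same
  operation on infinite sequences.\<close>

definition slice :: "nat \<Rightarrow> nat \<Rightarrow> nat \<Rightarrow> nat \<Rightarrow> nat" where
  "slice b p m c = list_encode (map (\<lambda>i. nthc c (prod_encode (p, prod_encode (b, i)))) [0..<m])"

text \<open>\<open>list_encode\<close> adds entries at the front, so primitive recursion builds the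
  list from its last entry; hence the index \<open>m - Suc n\<close>.\<close>

lemma slice_rec: "list_encode (map g [0..<m]) =
   rec_nat 0 (\<lambda>n r. Suc (prod_encode (g (m - Suc n), r))) m"
proof -
  have "n \<le> m \<Longrightarrow> list_encode (map g [m - n..<m]) = rec_nat 0 (\<lambda>n r. Suc (prod_encode (g (m - Suc n), r))) n" for n
  proof (induction n)
    case (Suc n)
    then have "[m - Suc n..<m] = (m - Suc n) # [m - n..<m]"
      by (metis Suc_diff_Suc Suc_le_lessD diff_less upt_conv_Cons zero_less_Suc less_le_trans)
    with Suc show ?case by simp
  qed simp
  from this[of m] show ?thesis by simp
qed

lemma computable_slice:
  assumes "computable k p" "computable k m" "computable k c"
  shows "computable k (\<lambda>xs. slice b (p xs) (m xs) (c xs))"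
proof -
  have "computable 3 (\<lambda>xs. slice b (xs ! 0) (xs ! 1) (xs ! 2))"
  proof (rule computable_rec_nat[where a = "\<lambda>xs. 0" and t = "\<lambda>xs. xs ! 1" and b = "\<lambda>xs. 
       Suc (prod_encode (nthc (xs ! 4) (prod_encode (xs ! 2, prod_encode (b, xs ! 3 - Suc (xs ! 0)))), xs ! 1))"])
  qed (auto simp: slice_def slice_rec intro!: computable_0 computable_nth computable_Suc computable_comp2[OF computable2_prod_encode] 
         computable_comp2[OF computable2_nthc] computable_comp2[OF computable2_minus] computable_const)
  from computable_comp[of "[p, m, c]", simplified, OF this[unfolded numeral_3_eq_3]] show ?thesis
    using assms by (simp add: numeral_2_eq_2)
qed

lemma re_domain_subst:
  assumes "computable k c" "\<forall>t\<in>set ts. computable k t"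
  obtains f' where "\<And>xs. length xs = k \<Longrightarrow>
    xs \<in> re_domain f' \<longleftrightarrow> c xs \<noteq> 0 \<and> map (\<lambda>t. t xs) ts \<in> re_domain f"
proof -
  obtain gs where gs:
    "\<And>xs ys. length xs = k \<Longrightarrow> list_all2 (\<lambda>g y. eval g xs y) gs ys \<longleftrightarrow> ys = map (\<lambda>h. h xs) ts"
    using list_all2_computable[OF assms(2)] by blast
  \<comment> \<open>The search variable is ignored: \<open>Mu g\<close> stops at 0 if
    \<open>c xs\<close> is positive and diverges otherwise. It serves as a guard for the computation
    of \<open>f\<close>.\<close>
  have "computable (Suc k) (\<lambda>xs. 1 - c (map (\<lambda>t. t xs) (map (\<lambda>i xs. xs ! Suc i) [0..<k])))"
    by (intro computable_comp2[OF computable2_minus] computable_const computable_comp) (use assms(1) in \<open>auto intro!: computable_nth\<close>)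
  then have "computable (Suc k) (\<lambda>xs. 1 - c (tl xs))"
    by (rule computable_cong) (auto simp: length_Suc_conv comp_def map_nth)
  then obtain g where g: "\<And>xs y. length xs = Suc k \<Longrightarrow> eval g xs y \<longleftrightarrow> y = 1 - c (tl xs)"
    unfolding computable_def by blast
  have "(\<exists>y. eval (Comp Zero [Comp f gs, Mu g]) xs y) \<longleftrightarrow> c xs \<noteq> 0 \<and> (\<exists>y. eval f (map (\<lambda>t. t xs) ts) y)"
    if "length xs = k" for xs
    using that by (auto simp: eval_Comp_iff[of Zero] eval_Comp_iff[of f] list_all2_Cons1 gs eval_Mu_iff g)
  then show ?thesis
    using that[of "Comp Zero [Comp f gs, Mu g]"] by (auto simp: re_domain_def)
qed

text \<open>Composition is strict, so a definition by cases runs each branch inside a primitive recursion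
  whose number of rounds is positive only if the branch is wanted.\<close>

lemma re_domain_branch:
  obtains f' where "\<And>n xs. length xs = k \<Longrightarrow>
    n # xs \<in> re_domain f' \<longleftrightarrow> (if n = 0 then xs \<in> re_domain f else xs \<in> re_domain g)"
proof -
  let ?args = "map (\<lambda>i. Proj (Suc (Suc i))) [0..<k]"
  let ?f = "PRec Zero (Comp Zero [Comp f ?args])" and ?g = "PRec Zero (Comp Zero [Comp g ?args])"
  have all2: "list_all2 (\<lambda>g y. eval g (a # b # xs) y) ?args ys \<longleftrightarrow> ys = xs" if "length xs = k" for a b xs ys
    using that by (auto simp: list_all2_conv_all_nth intro!: nth_equalityI)
  have loop: "(\<exists>y. eval (PRec Zero (Comp Zero [Comp f ?args])) (n # xs) y) \<longleftrightarrow> (n = 0 \<or> xs \<in> re_domain f)"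
    if "length xs = k" for n xs f
  proof -
    have "eval (PRec Zero (Comp Zero [Comp f ?args])) (n # xs) y \<longleftrightarrow> y = 0 \<and> (n = 0 \<or> xs \<in> re_domain f)" for y
      using that
      by (induction n arbitrary: y) (auto simp: eval_Comp_iff[of Zero] eval_Comp_iff[of f] list_all2_Cons1 all2 re_domain_def)
    then show ?thesis by auto
  qed
  have rest: "list_all2 (\<lambda>g y. eval g (n # xs) y) (map (\<lambda>i. Proj (Suc i)) [0..<k]) ys \<longleftrightarrow> ys = xs" 
    if "length xs = k" for n xs ys
    using that by (auto simp: list_all2_conv_all_nth intro!: nth_equalityI)
  have "computable 1 (\<lambda>xs. 1 - xs ! 0)" by (intro computable_comp2[OF computable2_minus] computable_const computable_nth) simp
  then obtain h where h: "\<And>n y. eval h [n] y \<longleftrightarrow> y = 1 - n"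
  proof (rule rcE, goal_cases)
    case (1 f)
    then show ?case using 1(1)[of f] by simp
  qed
  have h': "list_all2 (\<lambda>g y. eval g xs y) [Proj 0] ys \<longleftrightarrow> xs \<noteq> [] \<and> ys = [hd xs]" for xs ys
    by (cases xs) (auto simp: list_all2_Cons1)
  let ?h = "Comp Zero [Comp ?f (Comp h [Proj 0] # map (\<lambda>i. Proj (Suc i)) [0..<k]), 
     Comp ?g (Proj 0 # map (\<lambda>i. Proj (Suc i)) [0..<k])]"
  have "n # xs \<in> re_domain ?h \<longleftrightarrow> (if n = 0 then xs \<in> re_domain f else xs \<in> re_domain g)"
    if "length xs = k" for n xs
  proof -
    have c1: "eval (Comp F (Comp h [Proj 0] # map (\<lambda>i. Proj (Suc i)) [0..<k])) (n # xs) = eval F ((1 - n) # xs)" for F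
      by (rule ext) (simp add: eval_Comp_iff[of F] eval_Comp_iff[of h] list_all2_Cons1 rest[OF that] h h')
    have c2: "eval (Comp F (Proj 0 # map (\<lambda>i. Proj (Suc i)) [0..<k])) (n # xs) = eval F (n # xs)" for F
      by (rule ext) (simp add: eval_Comp_iff[of F] list_all2_Cons1 rest[OF that])
    have "n # xs \<in> re_domain ?h \<longleftrightarrow> (\<exists>y. eval ?f ((1 - n) # xs) y) \<and> (\<exists>y. eval ?g (n # xs) y)"
      by (simp add: re_domain_def eval_Comp_iff[of Zero] list_all2_Cons1 c1 c2)
    then show ?thesis using loop[OF that] by auto
  qed
  then show ?thesis using that by blast
qed

section \<open>Environments and closure of \<open>\<Sigma>\<^sup>1\<^sub>1\<close>\<close>

text \<open>An environment assigns values to infinitely many number variables and infinitely many function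
  variables; bound variables are numbered in the style of de Bruijn.\<close>

type_synonym env = "(nat \<Rightarrow> nat) \<times> (nat \<Rightarrow> baire)"

definition consN :: "nat \<Rightarrow> env \<Rightarrow> env" where "consN n e = (case_nat n (fst e), snd e)"
definition consF :: "baire \<Rightarrow> env \<Rightarrow> env" where "consF z e = (fst e, case_nat z (snd e))"
definition hdN :: "env \<Rightarrow> nat" where "hdN e = fst e 0"
definition tlN :: "env \<Rightarrow> env" where "tlN e = (fst e \<circ> Suc, snd e)"
definition hdF :: "env \<Rightarrow> baire" where "hdF e = snd e 0"
definition tlF :: "env \<Rightarrow> env" where "tlF e = (fst e, snd e \<circ> Suc)"

lemma cons_simps [simp]:
  "hdN (consN n e) = n" "tlN (consN n e) = e" "hdF (consN n e) = hdF e" "tlF (consN n e) = consN n (tlF e)"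
  "hdF (consF z e) = z" "tlF (consF z e) = e" "hdN (consF z e) = hdN e" "tlN (consF z e) = consF z (tlN e)"
  by (auto simp: consN_def consF_def hdN_def hdF_def tlN_def tlF_def comp_def prod_eq_iff)

text \<open>The closed matrix of a \<open>\<Sigma>\<^sup>1\<^sub>1\<close> formula: \<open>f\<close>
  enumerates basic neighbourhoods covering its complement. The witness \<open>y\<close> precedes the
  other functions, and every function is cut at a length of its own, as in
  \<open>sigma01\<close>.\<close>

definition avoids :: "recf \<Rightarrow> nat \<Rightarrow> nat \<Rightarrow> env \<Rightarrow> baire \<Rightarrow> bool" where
  "avoids f k l e y \<longleftrightarrow> (\<forall>m M. map (fst e) [0..<k] @ list_encode (restr y m) #
     map (\<lambda>j. list_encode (restr (snd e j) (M j))) [0..<l] \<notin> re_domain f)"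

definition S11kl :: "nat \<Rightarrow> nat \<Rightarrow> (env \<Rightarrow> bool) \<Rightarrow> bool" where
  "S11kl k l P \<longleftrightarrow> (\<exists>f. \<forall>e. P e \<longleftrightarrow> (\<exists>y. avoids f k l e y))"

lemma S11kl_rename:
  assumes "S11kl k l P" "\<forall>i<k. \<sigma> i < k'" "\<forall>j<l. \<tau> j < l'" "inj_on \<tau> {..<l}"
  shows "S11kl k' l' (\<lambda>e. P (fst e \<circ> \<sigma>, snd e \<circ> \<tau>))"
proof -
  obtain f where f: "\<And>e. P e \<longleftrightarrow> (\<exists>y. avoids f k l e y)"
    using assms(1) unfolding S11kl_def by blast
  let ?ts = "map (\<lambda>i xs. xs ! \<sigma> i) [0..<k] @ (\<lambda>xs. xs ! k') # map (\<lambda>j xs. xs ! (Suc k' + \<tau> j)) [0..<l]"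
  have ts: "\<forall>t\<in>set ?ts. computable (Suc (k' + l')) t"
    using assms(2,3) by (fastforce intro: computable_nth trans_less_add1)
  obtain f' where f': "\<And>xs. length xs = Suc (k' + l') \<Longrightarrow>
      xs \<in> re_domain f' \<longleftrightarrow> 1 \<noteq> (0::nat) \<and> map (\<lambda>t. t xs) ?ts \<in> re_domain f"
    by (rule re_domain_subst[where f = f, OF computable_const[of _ 1] ts]) blast
  have eq: "map (\<lambda>t. t (map (fst e) [0..<k'] @ c # map g [0..<l'])) ?ts =
      map (fst e \<circ> \<sigma>) [0..<k] @ c # map (g \<circ> \<tau>) [0..<l]" for e :: env and c g
    using assms(2,3) by (auto simp: nth_append)
  have "avoids f' k' l' e y \<longleftrightarrow> avoids f k l (fst e \<circ> \<sigma>, snd e \<circ> \<tau>) y" for e y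
  proof
    assume L: "avoids f' k' l' e y"
    show "avoids f k l (fst e \<circ> \<sigma>, snd e \<circ> \<tau>) y"
      unfolding avoids_def
    proof (intro allI)
      fix m M
      \<comment> \<open>Lengths for the old function variables are turned into lengths for the new
        ones, which is possible as \<open>\<tau>\<close> is injective. New variables outside its
        range are not read by \<open>f'\<close>.\<close>
      from L have "map (fst e) [0..<k'] @ list_encode (restr y m) #
         map (\<lambda>j. list_encode (restr (snd e j) (M (inv_into {..<l} \<tau> j)))) [0..<l'] \<notin> re_domain f'"
        unfolding avoids_def by (elim allE)
      moreover have "map ((\<lambda>j. list_encode (restr (snd e j) (M (inv_into {..<l} \<tau> j)))) \<circ> \<tau>) [0..<l] =
          map (\<lambda>j. list_encode (restr ((snd e \<circ> \<tau>) j) (M j))) [0..<l]"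
        using assms(4) by simp
      ultimately show "map (fst (fst e \<circ> \<sigma>, snd e \<circ> \<tau>)) [0..<k] @ list_encode (restr y m) #
         map (\<lambda>j. list_encode (restr (snd (fst e \<circ> \<sigma>, snd e \<circ> \<tau>) j) (M j))) [0..<l] \<notin> re_domain f"
        by (subst (asm) f') (simp_all only: eq, simp_all)
    qed
  next
    assume L: "avoids f k l (fst e \<circ> \<sigma>, snd e \<circ> \<tau>) y"
    show "avoids f' k' l' e y"
      unfolding avoids_def
    proof (intro allI)
      fix m M
      from L have "map (fst e \<circ> \<sigma>) [0..<k] @ list_encode (restr y m) #
         map (\<lambda>j. list_encode (restr ((snd e \<circ> \<tau>) j) ((M \<circ> \<tau>) j))) [0..<l] \<notin> re_domain f"
        unfolding avoids_def fst_conv snd_conv by (elim allE)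
      then show "map (fst e) [0..<k'] @ list_encode (restr y m) #
         map (\<lambda>j. list_encode (restr (snd e j) (M j))) [0..<l'] \<notin> re_domain f'"
        by (subst f') (simp_all only: eq, simp_all add: comp_def)
    qed
  qed
  with f show ?thesis unfolding S11kl_def by metis
qed

lemma S11kl_mono: "S11kl k l P \<Longrightarrow> k \<le> k' \<Longrightarrow> l \<le> l' \<Longrightarrow> S11kl k' l' P"
  using S11kl_rename[of k l P id k' id l'] by auto

lemma restr_simps [simp]: "length (restr x m) = m" "restr x 0 = []" 
    "restr (case_nat n y) (Suc m) = n # restr y m"
  unfolding restr_def by (simp_all add: map_upt_Suc del: upt_Suc)

text \<open>The number becomes the first digit of the witness, which is then
  \<open>case_nat n y\<close>. The empty segment does not yet reveal this digit, so the guard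
  \<open>xs ! k \<noteq> 0\<close> lets the machine diverge there.\<close>

lemma S11kl_ex_num:
  assumes "S11kl (Suc k) l P"
  shows "S11kl k l (\<lambda>e. \<exists>n. P (consN n e))"
proof -
  obtain f where f: "\<And>e. P e \<longleftrightarrow> (\<exists>y. avoids f (Suc k) l e y)"
    using assms(1) unfolding S11kl_def by blast
  let ?ts = "(\<lambda>xs. hdc (xs ! k)) # map (\<lambda>i xs. xs ! i) [0..<k] @ (\<lambda>xs. tlc (xs ! k)) # 
     map (\<lambda>j xs. xs ! (Suc k + j)) [0..<l]"
  obtain f' where f': "\<And>xs. length xs = Suc (k + l) \<Longrightarrow>
      xs \<in> re_domain f' \<longleftrightarrow> xs ! k \<noteq> 0 \<and> map (\<lambda>t. t xs) ?ts \<in> re_domain f"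
    by (rule re_domain_subst[of "Suc (k + l)" "\<lambda>xs. xs ! k" ?ts f])
       (auto intro!: computable_nth computable_comp1[OF computable1_hdc] computable_comp1[OF computable1_tlc])
  have eq: "map (\<lambda>t. t (map a [0..<k] @ c # map g [0..<l])) ?ts =
      map (case_nat (hdc c) a) [0..<Suc k] @ tlc c # map g [0..<l]" for a :: "nat \<Rightarrow> nat" and c g
    by (auto simp: nth_append map_upt_Suc simp del: upt_Suc)
  have dom: "map (fst e) [0..<k] @ list_encode s # map g [0..<l] \<in> re_domain f' \<longleftrightarrow>
     s \<noteq> [] \<and> map (fst (consN (hd s) e)) [0..<Suc k] @ list_encode (tl s) # map g [0..<l] \<in> re_domain f" for e s g
    by (subst f', simp, subst eq, cases "s = []") (simp_all add: nth_append consN_def hdc_encode del: upt_Suc)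
  have av: "avoids f' k l e (case_nat n y) \<longleftrightarrow> avoids f (Suc k) l (consN n e) y" for e n y
  proof -
    let ?in = "\<lambda>m M. map (fst e) [0..<k] @ list_encode (restr (case_nat n y) m) #
      map (\<lambda>j. list_encode (restr (snd e j) (M j))) [0..<l]"
    have in0: "?in 0 M \<notin> re_domain f'" for M
      unfolding dom by simp
    have inS: "?in (Suc m) M \<in> re_domain f' \<longleftrightarrow> map (fst (consN n e)) [0..<Suc k] @ list_encode (restr y m) #
      map (\<lambda>j. list_encode (restr (snd (consN n e) j) (M j))) [0..<l] \<in> re_domain f" for m M
      unfolding dom by (simp add: consN_def)
    have "avoids f' k l e (case_nat n y) \<longleftrightarrow> (\<forall>m M. ?in m M \<notin> re_domain f')"
      unfolding avoids_def ..
    also have "\<dots> \<longleftrightarrow> (\<forall>m M. ?in (Suc m) M \<notin> re_domain f')"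
      using in0 by (metis (mono_tags) not0_implies_Suc)
    also have "\<dots> \<longleftrightarrow> avoids f (Suc k) l (consN n e) y"
      unfolding inS avoids_def ..
    finally show ?thesis .
  qed
  have "(\<exists>y. avoids f' k l e y) \<longleftrightarrow> (\<exists>n. P (consN n e))" for e
  proof -
    have "y = case_nat (y 0) (y \<circ> Suc)" for y :: baire by (rule ext) (simp split: nat.split)
    then show ?thesis unfolding f av[symmetric] by metis
  qed
  then show ?thesis unfolding S11kl_def by metis
qed

definition col :: "nat \<Rightarrow> nat \<Rightarrow> baire \<Rightarrow> baire" where
  "col b p y = (\<lambda>i. y (prod_encode (p, prod_encode (b, i))))"

lemma slice_restr:
  assumes "prod_encode (p, prod_encode (b, m)) < n"
  shows "slice b p m (list_encode (restr y n)) = list_encode (restr (col b p y) m)"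
proof -
  have "nthc (list_encode (restr y n)) (prod_encode (p, prod_encode (b, i))) = col b p y i" if "i < m" for i
  proof -
    have "prod_encode (p, prod_encode (b, i)) \<le> prod_encode (p, prod_encode (b, m))"
      using that by (intro prod_encode_mono) auto
    with assms show ?thesis by (simp add: restr_def col_def)
  qed
  then show ?thesis unfolding slice_def restr_def by (auto intro!: arg_cong[of _ _ list_encode])
qed

text \<open>Both quantifiers are absorbed into the witness \<open>y\<close>. An initial segment of \<open>y\<close> has to
  provide initial segments, of independent lengths, of two of its columns; these lengths and the
  value of \<open>p\<close> are read off from the length of the initial segment.\<close>

lemma S11kl_all_ex:
  assumes "S11kl (Suc k) (Suc l) P"
  shows "S11kl k l (\<lambda>e. \<forall>p. \<exists>z. P (consN p (consF z e)))"
proof -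
  obtain f where f: "\<And>e. P e \<longleftrightarrow> (\<exists>y. avoids f (Suc k) (Suc l) e y)"
    using assms(1) unfolding S11kl_def by blast
  define dp where "dp c = fst (prod_decode (lenc c))" for c
  define d1 where "d1 c = fst (prod_decode (snd (prod_decode (lenc c))))" for c
  define d2 where "d2 c = fst (prod_decode (snd (prod_decode (snd (prod_decode (lenc c))))))" for c
  \<comment> \<open>Positive exactly if the segment is long enough: by monotonicity of pairing, the
    address with flag 1 and index \<open>d1 c + d2 c\<close> bounds all addresses needed in both
    columns.\<close>
  define cond where "cond c = lenc c - prod_encode (dp c, prod_encode (1, d1 c + d2 c))" for c
  have rcd: "computable K (\<lambda>xs. dp (xs ! k))" "computable K (\<lambda>xs. d1 (xs ! k))" "computable K (\<lambda>xs. d2 (xs ! k))" if "k < K" for K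
    unfolding dp_def d1_def d2_def using that
    by (auto intro!: computable_comp1[OF computable1_fst] computable_comp1[OF computable1_snd] computable_comp1[OF computable1_lenc] computable_nth)
  have rcc: "computable K (\<lambda>xs. cond (xs ! k))" if "k < K" for K
    unfolding cond_def using that
    by (intro computable_comp2[OF computable2_minus] computable_comp2[OF computable2_prod_encode] computable_comp2[OF computable2_plus] rcd
        computable_comp1[OF computable1_lenc] computable_nth computable_const)
  let ?ts = "(\<lambda>xs. dp (xs ! k)) # map (\<lambda>i xs. xs ! i) [0..<k] @ 
     (\<lambda>xs. slice 0 (dp (xs ! k)) (d1 (xs ! k)) (xs ! k)) # 
     (\<lambda>xs. slice 1 (dp (xs ! k)) (d2 (xs ! k)) (xs ! k)) # 
     map (\<lambda>j xs. xs ! (Suc k + j)) [0..<l]"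
  obtain f' where f': "\<And>xs. length xs = Suc (k + l) \<Longrightarrow>
      xs \<in> re_domain f' \<longleftrightarrow> cond (xs ! k) \<noteq> 0 \<and> map (\<lambda>t. t xs) ?ts \<in> re_domain f"
    by (rule re_domain_subst[of "Suc (k + l)" "\<lambda>xs. cond (xs ! k)" ?ts f])
       (auto intro!: computable_nth rcd rcc computable_slice)
  have eq: "map (\<lambda>t. t (map a [0..<k] @ c # map g [0..<l])) ?ts =
      map (case_nat (dp c) a) [0..<Suc k] @ slice 0 (dp c) (d1 c) c # slice 1 (dp c) (d2 c) c # map g [0..<l]" 
    for a :: "nat \<Rightarrow> nat" and c g
    by (auto simp: nth_append map_upt_Suc simp del: upt_Suc)
  have dom: "map (fst e) [0..<k] @ c # map g [0..<l] \<in> re_domain f' \<longleftrightarrow>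
     cond c \<noteq> 0 \<and> map (fst (consN (dp c) e)) [0..<Suc k] @ slice 0 (dp c) (d1 c) c # slice 1 (dp c) (d2 c) c #
       map g [0..<l] \<in> re_domain f" for e c g
    by (subst f', simp, subst eq) (auto simp: nth_append consN_def)
  have sl: "slice 0 (dp c) (d1 c) c = list_encode (restr (col 0 (dp c) y) (d1 c))" 
      "slice 1 (dp c) (d2 c) c = list_encode (restr (col 1 (dp c) y) (d2 c))" 
    if "cond c \<noteq> 0" "c = list_encode (restr y n)" for c y n
  proof -
    have lt: "prod_encode (dp c, prod_encode (1, d1 c + d2 c)) < n"
      using that(1) unfolding cond_def by (simp add: that(2))
    have "prod_encode (dp c, prod_encode (0, d1 c)) \<le> prod_encode (dp c, prod_encode (1, d1 c + d2 c))"
         "prod_encode (dp c, prod_encode (1, d2 c)) \<le> prod_encode (dp c, prod_encode (1, d1 c + d2 c))"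
      by (intro prod_encode_mono; simp)+
    with lt have lt': "prod_encode (dp c, prod_encode (0, d1 c)) < n" "prod_encode (dp c, prod_encode (1, d2 c)) < n"
      by linarith+
    show "slice 0 (dp c) (d1 c) c = list_encode (restr (col 0 (dp c) y) (d1 c))"
      using slice_restr[OF lt'(1)] that(2) by simp
    show "slice 1 (dp c) (d2 c) c = list_encode (restr (col 1 (dp c) y) (d2 c))"
      using slice_restr[OF lt'(2)] that(2) by simp
  qed
  have av: "avoids f' k l e y \<longleftrightarrow> (\<forall>p. avoids f (Suc k) (Suc l) (consN p (consF (col 1 p y) e)) (col 0 p y))" for e y
  proof
    assume L: "avoids f' k l e y"
    show "\<forall>p. avoids f (Suc k) (Suc l) (consN p (consF (col 1 p y) e)) (col 0 p y)"
      unfolding avoids_def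
    proof (intro allI notI)
      fix p m M
      assume H: "map (fst (consN p (consF (col 1 p y) e))) [0..<Suc k] @ list_encode (restr (col 0 p y) m) # 
        map (\<lambda>j. list_encode (restr (snd (consN p (consF (col 1 p y) e)) j) (M j))) [0..<Suc l] \<in> re_domain f"
      \<comment> \<open>The length must name \<open>p\<close>, \<open>m\<close> and
        \<open>M 0\<close>; its last component is padding. A pair is at least as large as its second
        component, so the padding makes the segment satisfy \<open>cond\<close>.\<close>
      define c where "c = list_encode (restr y (prod_encode (p, prod_encode (m, prod_encode (M 0, 
        Suc (prod_encode (p, prod_encode (1, m + M 0))))))))"
      have d: "dp c = p" "d1 c = m" "d2 c = M 0" by (simp_all add: dp_def d1_def d2_def c_def)
      have "Suc x \<le> prod_encode (p, prod_encode (m, prod_encode (M 0, Suc x)))" for x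
        by (meson le_prod_encode_2 order_trans)
      from this[of "prod_encode (p, prod_encode (1, m + M 0))"] have c0: "cond c \<noteq> 0"
        unfolding cond_def d by (simp add: c_def Suc_le_eq not_le)
      from L have "map (fst e) [0..<k] @ c # map (\<lambda>j. list_encode (restr (snd e j) ((M \<circ> Suc) j))) [0..<l] \<notin> re_domain f'"
        unfolding avoids_def c_def by (elim allE)
      with H show False
        unfolding dom sl[OF c0 c_def, unfolded d] d using c0
        by (simp add: consN_def consF_def map_upt_Suc del: upt_Suc)
    qed
  next
    assume R: "\<forall>p. avoids f (Suc k) (Suc l) (consN p (consF (col 1 p y) e)) (col 0 p y)"
    show "avoids f' k l e y"
      unfolding avoids_def
    proof (intro allI notI)
      fix m M
      assume H: "map (fst e) [0..<k] @ list_encode (restr y m) # map (\<lambda>j. list_encode (restr (snd e j) (M j))) [0..<l] \<in> re_domain f'"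
      define c where "c = list_encode (restr y m)"
      from H have c0: "cond c \<noteq> 0" unfolding c_def[symmetric] dom by simp
      from R have "map (fst (consN (dp c) (consF (col 1 (dp c) y) e))) [0..<Suc k] @ list_encode (restr (col 0 (dp c) y) (d1 c)) # 
        map (\<lambda>j. list_encode (restr (snd (consN (dp c) (consF (col 1 (dp c) y) e)) j) (case_nat (d2 c) M j))) [0..<Suc l] \<notin> re_domain f"
        unfolding avoids_def by (elim allE)
      with H show False
        unfolding c_def[symmetric] dom sl[OF c0 c_def] 
        by (simp add: consN_def consF_def map_upt_Suc del: upt_Suc)
    qed
  qed
  have "(\<exists>y. avoids f' k l e y) \<longleftrightarrow> (\<forall>p. \<exists>z. P (consN p (consF z e)))" for e
  proof
    assume "\<exists>y. avoids f' k l e y"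
    then show "\<forall>p. \<exists>z. P (consN p (consF z e))" unfolding av f by blast
  next
    assume "\<forall>p. \<exists>z. P (consN p (consF z e))"
    then obtain Z Y where ZY: "\<And>p. avoids f (Suc k) (Suc l) (consN p (consF (Z p) e)) (Y p)"
      unfolding f by metis
    define y where "y c = (case prod_decode c of (p, d) \<Rightarrow> case prod_decode d of (b, i) \<Rightarrow> if b = 0 then Y p i else Z p i)" for c
    have "col 0 p y = Y p" "col 1 p y = Z p" for p
      by (auto simp: col_def y_def)
    with ZY have "avoids f' k l e y" unfolding av by simp
    then show "\<exists>y. avoids f' k l e y" by blast
  qed
  then show ?thesis unfolding S11kl_def by metis
qed

text \<open>Quantifying the number variable universally or existentially turns this case distinction
  into a conjunction or a disjunction.\<close>

lemma S11kl_branch: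
  assumes "S11kl k l P" "S11kl k l Q"
  shows "S11kl (Suc k) l (\<lambda>e. if hdN e = 0 then P (tlN e) else Q (tlN e))"
proof -
  obtain f where f: "\<And>e. P e \<longleftrightarrow> (\<exists>y. avoids f k l e y)"
    using assms(1) unfolding S11kl_def by blast
  obtain g where g: "\<And>e. Q e \<longleftrightarrow> (\<exists>y. avoids g k l e y)"
    using assms(2) unfolding S11kl_def by blast
  obtain h where h: "\<And>n xs. length xs = Suc (k + l) \<Longrightarrow>
      n # xs \<in> re_domain h \<longleftrightarrow> (if n = 0 then xs \<in> re_domain f else xs \<in> re_domain g)"
    using re_domain_branch by blast
  have "avoids h (Suc k) l e y \<longleftrightarrow> (if hdN e = 0 then avoids f k l (tlN e) y else avoids g k l (tlN e) y)" for e y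
    unfolding avoids_def map_upt_Suc append_Cons
    by (subst h) (simp_all add: hdN_def tlN_def comp_def)
  with f g show ?thesis unfolding S11kl_def by (intro exI[of _ h]) auto
qed

lemma S11kl_computable:
  assumes "computable k h"
  shows "S11kl k 0 (\<lambda>e. h (map (fst e) [0..<k]) = 0)"
proof -
  have "computable (Suc k) (\<lambda>xs. h (map (\<lambda>t. t xs) (map (\<lambda>i xs. xs ! i) [0..<k])))"
    by (rule computable_comp) (use assms in \<open>auto intro!: computable_nth\<close>)
  then obtain f' where f': "\<And>xs. length xs = Suc k \<Longrightarrow>
      xs \<in> re_domain f' \<longleftrightarrow> h (map (\<lambda>t. t xs) (map (\<lambda>i xs. xs ! i) [0..<k])) \<noteq> 0 \<and> map (\<lambda>t. t xs) [] \<in> re_domain Zero"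
    by (rule re_domain_subst[of _ _ "[]" Zero]) auto
  have "avoids f' k 0 e y \<longleftrightarrow> h (map (fst e) [0..<k]) = 0" for e y
  proof -
    have "map (\<lambda>i. (map (fst e) [0..<k] @ c) ! i) [0..<k] = map (fst e) [0..<k]" for c
      by (rule nth_equalityI) (auto simp: nth_append)
    note eq = this
    show ?thesis
      unfolding avoids_def by (subst f') (auto simp: re_domain_def comp_def eq[unfolded comp_def])
  qed
  then show ?thesis unfolding S11kl_def by metis
qed

lemma S11kl_app: "S11kl 2 1 (\<lambda>e. snd e 0 (fst e 0) = fst e 1)"
proof -
  \<comment> \<open>Truncated subtraction as propositional logic: positive exactly if the segment in
    place 3 is longer than \<open>xs ! 0\<close> and its entry there differs from
    \<open>xs ! 1\<close>. Place 2 holds the segment of the witness.\<close>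
  let ?c = "\<lambda>xs :: nat list. 1 - ((1 - (lenc (xs ! 3) - xs ! 0)) + 
     (1 - ((nthc (xs ! 3) (xs ! 0) - xs ! 1) + (xs ! 1 - nthc (xs ! 3) (xs ! 0)))))"
  have "computable 4 ?c"
    by (intro computable_comp2[OF computable2_minus] computable_comp2[OF computable2_plus] computable_comp2[OF computable2_nthc] computable_comp1[OF computable1_lenc] computable_const computable_nth) simp_all
  then obtain f' where f': "\<And>xs. length xs = 4 \<Longrightarrow>
      xs \<in> re_domain f' \<longleftrightarrow> ?c xs \<noteq> 0 \<and> map (\<lambda>t. t xs) [] \<in> re_domain Zero"
    by (rule re_domain_subst[of _ _ "[]" Zero]) auto
  have dom: "[n, m, s, list_encode t] \<in> re_domain f' \<longleftrightarrow> n < length t \<and> t ! n \<noteq> m" for n m s t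
    by (subst f', simp, cases "n < length t") (auto simp: re_domain_def numeral_eq_Suc)
  have "avoids f' 2 1 e y \<longleftrightarrow> snd e 0 (fst e 0) = fst e 1" for e y
  proof -
    have "avoids f' 2 1 e y \<longleftrightarrow> (\<forall>M. \<not> (fst e 0 < M \<and> restr (snd e 0) M ! fst e 0 \<noteq> fst e 1))"
      unfolding avoids_def numeral_2_eq_2 One_nat_def map_upt_Suc 
      by (auto simp: dom)
    also have "\<dots> \<longleftrightarrow> snd e 0 (fst e 0) = fst e 1"
      by (auto simp: restr_def)
    finally show ?thesis .
  qed
  then show ?thesis unfolding S11kl_def by metis
qed

definition S11 :: "(env \<Rightarrow> bool) \<Rightarrow> bool" where
  "S11 P \<longleftrightarrow> (\<exists>k l. S11kl k l P)"

definition D11 :: "(env \<Rightarrow> bool) \<Rightarrow> bool" where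
  "D11 P \<longleftrightarrow> S11 P \<and> S11 (\<lambda>e. \<not> P e)"

lemma S11_ex_num: "S11 (\<lambda>e. P (tlN e) (hdN e)) \<Longrightarrow> S11 (\<lambda>e. \<exists>n. P e n)"
  unfolding S11_def
proof (elim exE)
  fix k l assume "S11kl k l (\<lambda>e. P (tlN e) (hdN e))"
  then have "S11kl (Suc k) l (\<lambda>e. P (tlN e) (hdN e))" by (rule S11kl_mono) auto
  from S11kl_ex_num[OF this] show "\<exists>k l. S11kl k l (\<lambda>e. \<exists>n. P e n)" by auto
qed

lemma S11_all_ex: "S11 (\<lambda>e. P (tlN (tlF e)) (hdN e) (hdF e)) \<Longrightarrow> S11 (\<lambda>e. \<forall>n. \<exists>z. P e n z)"
  unfolding S11_def
proof (elim exE)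
  fix k l assume "S11kl k l (\<lambda>e. P (tlN (tlF e)) (hdN e) (hdF e))"
  then have "S11kl (Suc k) (Suc l) (\<lambda>e. P (tlN (tlF e)) (hdN e) (hdF e))" by (rule S11kl_mono) auto
  from S11kl_all_ex[OF this] show "\<exists>k l. S11kl k l (\<lambda>e. \<forall>n. \<exists>z. P e n z)" by auto
qed

lemma S11_branch: "S11 P \<Longrightarrow> S11 Q \<Longrightarrow> S11 (\<lambda>e. if hdN e = 0 then P (tlN e) else Q (tlN e))"
  unfolding S11_def
proof (elim exE)
  fix k l k' l' assume "S11kl k l P" "S11kl k' l' Q"
  then have "S11kl (max k k') (max l l') P" "S11kl (max k k') (max l l') Q"
    by (auto intro: S11kl_mono)
  from S11kl_branch[OF this] show "\<exists>k l. S11kl k l (\<lambda>e. if hdN e = 0 then P (tlN e) else Q (tlN e))" by blast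
qed

text \<open>Renamings have to be injective on function variables, since identifying two function variables
  does not act on a single pair of initial segments.\<close>

definition renaming :: "(env \<Rightarrow> env) \<Rightarrow> bool" where
  "renaming \<rho> \<longleftrightarrow> (\<exists>\<sigma> \<tau>. inj \<tau> \<and> \<rho> = (\<lambda>e. (fst e \<circ> \<sigma>, snd e \<circ> \<tau>)))"

lemma S11_renaming:
  assumes "S11 P" "renaming \<rho>"
  shows "S11 (\<lambda>e. P (\<rho> e))"
proof -
  obtain k l where kl: "S11kl k l P" using assms(1) unfolding S11_def by blast
  obtain \<sigma> \<tau> where \<rho>: "inj \<tau>" "\<rho> = (\<lambda>e. (fst e \<circ> \<sigma>, snd e \<circ> \<tau>))"
    using assms(2) unfolding renaming_def by blast
  have "\<forall>i<k. \<sigma> i < Suc (Max (insert 0 (\<sigma> ` {..<k})))" "\<forall>j<l. \<tau> j < Suc (Max (insert 0 (\<tau> ` {..<l})))"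
    by (auto simp: less_Suc_eq_le intro!: Max_ge)
  from S11kl_rename[OF kl this] \<rho>(1) show ?thesis
    unfolding S11_def \<rho>(2) by (blast intro: inj_on_subset)
qed

lemma renaming_id: "renaming (\<lambda>e. e)"
  unfolding renaming_def by (intro exI[of _ id]) auto

lemma renaming_tlN: "renaming \<rho> \<Longrightarrow> renaming (\<lambda>e. tlN (\<rho> e))"
  unfolding renaming_def tlN_def
proof (elim exE conjE)
  fix \<sigma> \<tau> assume "inj (\<tau> :: nat \<Rightarrow> nat)" "\<rho> = (\<lambda>e. (fst e \<circ> \<sigma>, snd e \<circ> \<tau>))"
  then show "\<exists>\<sigma> \<tau>. inj \<tau> \<and> (\<lambda>e. (fst (\<rho> e) \<circ> Suc, snd (\<rho> e))) = (\<lambda>e. (fst e \<circ> \<sigma>, snd e \<circ> \<tau>))"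
    by (intro exI[of _ "\<sigma> \<circ> Suc"] exI[of _ \<tau>]) (auto simp: comp_assoc)
qed

lemma renaming_tlF: "renaming \<rho> \<Longrightarrow> renaming (\<lambda>e. tlF (\<rho> e))"
  unfolding renaming_def tlF_def
proof (elim exE conjE)
  fix \<sigma> \<tau> assume "inj (\<tau> :: nat \<Rightarrow> nat)" "\<rho> = (\<lambda>e. (fst e \<circ> \<sigma>, snd e \<circ> \<tau>))"
  then show "\<exists>\<sigma> \<tau>. inj \<tau> \<and> (\<lambda>e. (fst (\<rho> e), snd (\<rho> e) \<circ> Suc)) = (\<lambda>e. (fst e \<circ> \<sigma>, snd e \<circ> \<tau>))"
    by (intro exI[of _ "\<sigma>"] exI[of _ "\<tau> \<circ> Suc"]) (auto simp: comp_assoc inj_compose)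
qed

text \<open>Universal number quantifiers and existential function quantifiers both come from
  \<open>S11_all_ex\<close>: here with a dummy function variable, in \<open>S11_ex_fun\<close> with
  a dummy number variable.\<close>

lemma S11_all_num: "S11 (\<lambda>e. P (tlN e) (hdN e)) \<Longrightarrow> S11 (\<lambda>e. \<forall>n. P e n)"
  using S11_all_ex[of "\<lambda>e n z. P e n"] S11_renaming[OF _ renaming_tlF[OF renaming_id], of "\<lambda>e. P (tlN e) (hdN e)"]
  by (simp add: hdN_def tlF_def)

lemma S11_ex_fun: "S11 (\<lambda>e. P (tlF e) (hdF e)) \<Longrightarrow> S11 (\<lambda>e. \<exists>z. P e z)"
  using S11_all_ex[of "\<lambda>e n z. P e z"] S11_renaming[OF _ renaming_tlN[OF renaming_id], of "\<lambda>e. P (tlF e) (hdF e)"]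
  by (simp add: hdF_def tlN_def tlF_def)

lemma S11_conj: assumes "S11 P" "S11 Q" shows "S11 (\<lambda>e. P e \<and> Q e)"
proof -
  have "S11 (\<lambda>e. \<forall>n. if n = (0::nat) then P e else Q e)"
    using S11_branch[OF assms] by (rule S11_all_num)
  moreover have "(\<forall>n. if n = (0::nat) then P e else Q e) \<longleftrightarrow> P e \<and> Q e" for e
    by (metis zero_neq_one)
  ultimately show ?thesis by simp
qed

lemma S11_disj: assumes "S11 P" "S11 Q" shows "S11 (\<lambda>e. P e \<or> Q e)"
proof -
  have "S11 (\<lambda>e. \<exists>n. if n = (0::nat) then P e else Q e)"
    using S11_branch[OF assms] by (rule S11_ex_num)
  moreover have "(\<exists>n. if n = (0::nat) then P e else Q e) \<longleftrightarrow> P e \<or> Q e" for e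
    by (metis zero_neq_one)
  ultimately show ?thesis by simp
qed

section \<open>A calculus of \<open>\<Delta>\<^sup>1\<^sub>1\<close> relations\<close>

named_theorems D11_intros

lemma D11_S11: "D11 P \<Longrightarrow> S11 P"
  by (simp add: D11_def)

lemma D11_not [D11_intros]: "D11 P \<Longrightarrow> D11 (\<lambda>e. \<not> P e)"
  by (simp add: D11_def)

lemma D11_conj [D11_intros]: "D11 P \<Longrightarrow> D11 Q \<Longrightarrow> D11 (\<lambda>e. P e \<and> Q e)"
  unfolding D11_def de_Morgan_conj
  using S11_conj[of P Q] S11_disj[of "\<lambda>e. \<not> P e" "\<lambda>e. \<not> Q e"] by blast

lemma D11_disj [D11_intros]: "D11 P \<Longrightarrow> D11 Q \<Longrightarrow> D11 (\<lambda>e. P e \<or> Q e)"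
  unfolding D11_def de_Morgan_disj
  using S11_disj[of P Q] S11_conj[of "\<lambda>e. \<not> P e" "\<lambda>e. \<not> Q e"] by blast

lemma D11_imp [D11_intros]: "D11 P \<Longrightarrow> D11 Q \<Longrightarrow> D11 (\<lambda>e. P e \<longrightarrow> Q e)"
  unfolding imp_conv_disj by (intro D11_disj D11_not)

lemma D11_iff [D11_intros]: "D11 P \<Longrightarrow> D11 Q \<Longrightarrow> D11 (\<lambda>e. P e \<longleftrightarrow> Q e)"
  unfolding iff_conv_conj_imp by (intro D11_conj D11_imp)

lemma D11_ex_num [D11_intros]: "D11 (\<lambda>e. P (tlN e) (hdN e)) \<Longrightarrow> D11 (\<lambda>e. \<exists>n. P e n)"
  unfolding D11_def using S11_ex_num[of P] S11_all_num[of "\<lambda>e n. \<not> P e n"] by simp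

lemma D11_all_num [D11_intros]: "D11 (\<lambda>e. P (tlN e) (hdN e)) \<Longrightarrow> D11 (\<lambda>e. \<forall>n. P e n)"
  unfolding D11_def using S11_all_num[of P] S11_ex_num[of "\<lambda>e n. \<not> P e n"] by simp

lemma D11_renaming: "D11 P \<Longrightarrow> renaming \<rho> \<Longrightarrow> D11 (\<lambda>e. P (\<rho> e))"
  unfolding D11_def using S11_renaming[of P \<rho>] S11_renaming[of "\<lambda>e. \<not> P e" \<rho>] by simp

lemmas [D11_intros] = renaming_id renaming_tlN renaming_tlF

lemma D11_computable:
  assumes "computable k h"
  shows "D11 (\<lambda>e. h (map (fst e) [0..<k]) = 0)"
proof -
  have "computable k (\<lambda>xs. 1 - h xs)" using assms by (intro computable_comp2[OF computable2_minus] computable_const)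
  from S11kl_computable[OF this] S11kl_computable[OF assms] show ?thesis
    unfolding D11_def S11_def by (auto simp: Suc_le_eq)
qed

lemma D11_eq_var: "D11 (\<lambda>e. fst e i = fst e j)"
proof -
  have "computable (Suc (max i j)) (\<lambda>xs. (xs ! i - xs ! j) + (xs ! j - xs ! i))"
    by (intro computable_comp2[OF computable2_minus] computable_comp2[OF computable2_plus] computable_nth) auto
  from D11_computable[OF this] show ?thesis
    by (rule back_subst[of D11]) (auto simp: fun_eq_iff less_Suc_eq_le simp del: upt_Suc)
qed

lemma D11_app_var: "D11 (\<lambda>e. snd e j (fst e i) = fst e i')"
proof -
  have app: "S11 (\<lambda>e. snd e j (fst e i) = fst e i')" for i i'
  proof -
    have "renaming (\<lambda>e. (fst e \<circ> case_nat i (\<lambda>_. i'), snd e \<circ> (\<lambda>n. n + j)))"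
      unfolding renaming_def by (intro exI[of _ "case_nat i (\<lambda>_. i')"] exI[of _ "\<lambda>n. n + j"]) (auto simp: inj_def)
    moreover have "S11 (\<lambda>e. snd e 0 (fst e 0) = fst e 1)"
      using S11kl_app S11_def by blast
    ultimately show ?thesis using S11_renaming by fastforce
  qed
  \<comment> \<open>An inequation is again \<open>\<Sigma>\<^sup>1\<^sub>1\<close>: the function
    takes some value, and that value is a different one.\<close>
  have "S11 (\<lambda>e. \<exists>m. snd e j (fst e i) = m \<and> \<not> m = fst e i')"
  proof (rule S11_ex_num, rule S11_conj)
    show "S11 (\<lambda>e. snd (tlN e) j (fst (tlN e) i) = hdN e)"
      using app[of "Suc i" 0] by (simp add: tlN_def hdN_def)
    show "S11 (\<lambda>e. \<not> hdN e = fst (tlN e) i')"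
      using D11_eq_var[of 0 "Suc i'"] by (simp add: tlN_def hdN_def D11_def)
  qed
  with app show ?thesis by (simp add: D11_def)
qed

section \<open>Number terms and list terms\<close>

definition D11_num :: "(env \<Rightarrow> nat) \<Rightarrow> bool" where
  "D11_num t \<longleftrightarrow> D11 (\<lambda>e. t (tlN e) = hdN e)"

text \<open>A term is eliminated by quantifying over its value, and number quantifiers do not leave
  \<open>\<Delta>\<^sup>1\<^sub>1\<close>.\<close>

lemma D11_subst: "D11 (\<lambda>e. P (tlN e) (hdN e)) \<Longrightarrow> D11_num t \<Longrightarrow> D11 (\<lambda>e. P e (t e))"
  using D11_ex_num[of "\<lambda>e n. t e = n \<and> P e n"] D11_conj unfolding D11_num_def by simp

lemma D11_num_renaming:
  assumes "D11_num t" "renaming \<rho>" shows "D11_num (\<lambda>e. t (\<rho> e))"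
proof -
  obtain \<sigma> \<tau> where \<rho>: "inj \<tau>" "\<rho> = (\<lambda>e. (fst e \<circ> \<sigma>, snd e \<circ> \<tau>))"
    using assms(2) unfolding renaming_def by blast
  have "renaming (\<lambda>e. (fst e \<circ> case_nat 0 (Suc \<circ> \<sigma>), snd e \<circ> \<tau>))"
    unfolding renaming_def using \<rho>(1) by blast
  from D11_renaming[OF assms(1)[unfolded D11_num_def] this] show ?thesis
    unfolding D11_num_def \<rho>(2) by (simp add: tlN_def hdN_def comp_def)
qed

lemma D11_num_tlN: "D11_num t \<Longrightarrow> D11_num (\<lambda>e. t (tlN e))"
  by (rule D11_num_renaming[OF _ renaming_tlN[OF renaming_id]])

lemma D11_num_hdN [D11_intros]: "renaming \<rho> \<Longrightarrow> D11_num (\<lambda>e. hdN (\<rho> e))"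
proof (rule D11_num_renaming)
  show "D11_num hdN"
    using D11_eq_var[of 1 0] by (simp add: D11_num_def hdN_def tlN_def)
qed

lemma D11_subst2:
  assumes "D11 (\<lambda>e. P (tlN (tlN e)) (hdN (tlN e)) (hdN e))" "D11_num s" "D11_num t"
  shows "D11 (\<lambda>e. P e (s e) (t e))"
  by (rule D11_subst[OF D11_subst[OF assms(1) D11_num_tlN[OF assms(3)]] assms(2)])

lemma D11_subst3:
  assumes "D11 (\<lambda>e. P (tlN (tlN (tlN e))) (hdN (tlN (tlN e))) (hdN (tlN e)) (hdN e))" "D11_num r" "D11_num s" "D11_num t"
  shows "D11 (\<lambda>e. P e (r e) (s e) (t e))"
  by (rule D11_subst2[OF D11_subst[OF assms(1) D11_num_tlN[OF D11_num_tlN[OF assms(4)]]] assms(2,3)])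

lemma D11_num_app [D11_intros]:
  assumes "renaming \<rho>" "D11_num t" shows "D11_num (\<lambda>e. hdF (\<rho> e) (t e))"
proof -
  obtain \<sigma> \<tau> where \<rho>: "inj \<tau>" "\<rho> = (\<lambda>e. (fst e \<circ> \<sigma>, snd e \<circ> \<tau>))"
    using assms(1) unfolding renaming_def by blast
  have "D11 (\<lambda>e. hdF (\<rho> (tlN (tlN e))) (hdN e) = hdN (tlN e))"
    using D11_app_var[of "\<tau> 0" 0 1] by (simp add: \<rho>(2) tlN_def hdN_def hdF_def)
  from D11_subst[OF this D11_num_tlN[OF assms(2)]] show ?thesis
    unfolding D11_num_def .
qed

lemma D11_num_computable1:
  assumes "computable1 h" "D11_num t"
  shows "D11_num (\<lambda>e. h (t e))"
proof -
  have "computable 2 (\<lambda>xs. (h (xs ! 0) - xs ! 1) + (xs ! 1 - h (xs ! 0)))"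
    by (intro computable_comp2[OF computable2_minus] computable_comp2[OF computable2_plus] computable_comp1[OF assms(1)] computable_nth) auto
  from D11_computable[OF this] have "D11 (\<lambda>e. h (hdN e) = hdN (tlN e))"
    by (rule back_subst[of D11]) (auto simp: fun_eq_iff numeral_2_eq_2 hdN_def tlN_def)
  from D11_subst[of "\<lambda>e n. h n = hdN e", OF this D11_num_tlN[OF assms(2)]] show ?thesis
    unfolding D11_num_def .
qed

lemma D11_eq [D11_intros]: "D11_num s \<Longrightarrow> D11_num t \<Longrightarrow> D11 (\<lambda>e. s e = t e)"
  by (rule D11_subst2[where P = "\<lambda>_ m n. m = n"]) (simp_all add: hdN_def tlN_def D11_eq_var)

lemma D11_num_computable2:
  assumes "computable2 h" "D11_num s" "D11_num t"
  shows "D11_num (\<lambda>e. h (s e) (t e))"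
  unfolding D11_num_def
proof (rule D11_subst2[where P = "\<lambda>e m n. h m n = hdN e", OF _ D11_num_tlN[OF assms(2)] D11_num_tlN[OF assms(3)]])
  have "computable 3 (\<lambda>xs. (h (xs ! 1) (xs ! 0) - xs ! 2) + (xs ! 2 - h (xs ! 1) (xs ! 0)))"
    by (intro computable_comp2[OF computable2_minus] computable_comp2[OF computable2_plus] computable_comp2[OF assms(1)] computable_nth) auto
  from D11_computable[OF this] show "D11 (\<lambda>e. h (hdN (tlN e)) (hdN e) = hdN (tlN (tlN e)))"
    by (rule back_subst[of D11]) (auto simp: fun_eq_iff numeral_3_eq_3 numeral_2_eq_2 hdN_def tlN_def)
qed

lemma D11_num_const [D11_intros]: "D11_num (\<lambda>e. n)"
proof -
  have "computable 1 (\<lambda>xs. (n - xs ! 0) + (xs ! 0 - n))"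
    by (intro computable_comp2[OF computable2_minus] computable_comp2[OF computable2_plus] computable_const computable_nth) auto
  from D11_computable[OF this] show ?thesis
    unfolding D11_num_def by (rule back_subst[of D11]) (auto simp: fun_eq_iff hdN_def)
qed

lemma D11_const [D11_intros]: "D11 (\<lambda>e. b)"
  using D11_eq[OF D11_num_const[of 0] D11_num_const[of "if b then 0 else 1"]] by (cases b) auto

lemmas [D11_intros] = D11_num_computable1[OF computable1_Suc] D11_num_computable2[OF computable2_plus] D11_num_computable2[OF computable2_minus]
  D11_num_computable2[OF computable2_prod_encode] D11_num_computable1[OF computable1_fst] D11_num_computable1[OF computable1_snd] D11_num_computable2[OF computable2_nthc]

lemma D11_le [D11_intros]: "D11_num s \<Longrightarrow> D11_num t \<Longrightarrow> D11 (\<lambda>e. s e \<le> t e)"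
  using D11_eq[OF D11_num_computable2[OF computable2_minus] D11_num_const[of 0], of s t] by simp

lemma D11_less [D11_intros]: "D11_num s \<Longrightarrow> D11_num t \<Longrightarrow> D11 (\<lambda>e. s e < t e)"
  using D11_not[OF D11_le[of t s]] by (simp add: not_le)

definition D11_list :: "(env \<Rightarrow> nat list) \<Rightarrow> bool" where
  "D11_list t \<longleftrightarrow> D11_num (\<lambda>e. list_encode (t e))"

lemma D11_num_list_encode [D11_intros]: "D11_list t \<Longrightarrow> D11_num (\<lambda>e. list_encode (t e))"
  by (simp add: D11_list_def)

lemma D11_list_list_decode [D11_intros]: "D11_num t \<Longrightarrow> D11_list (\<lambda>e. list_decode (t e))"
  by (simp add: D11_list_def)

lemma D11_list_Nil [D11_intros]: "D11_list (\<lambda>e. [])"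
  by (simp add: D11_list_def D11_num_const)

lemma D11_list_Cons [D11_intros]:
  assumes "D11_num s" "D11_list t" shows "D11_list (\<lambda>e. s e # t e)"
  unfolding D11_list_def[of "\<lambda>e. s e # t e"] list_encode.simps by (intro D11_intros assms)

lemma D11_num_length [D11_intros]: "D11_list t \<Longrightarrow> D11_num (\<lambda>e. length (t e))"
  using D11_num_computable1[OF computable1_lenc D11_num_list_encode, of t] by simp

lemma ex_list_decode: "(\<exists>s. Q s) \<longleftrightarrow> (\<exists>n. Q (list_decode n))"
  and all_list_decode: "(\<forall>s. Q s) \<longleftrightarrow> (\<forall>n. Q (list_decode n))"
  by (metis list_encode_inverse)+

lemma D11_ex_list [D11_intros]: 
  "D11 (\<lambda>e. P (tlN e) (list_decode (hdN e))) \<Longrightarrow> D11 (\<lambda>e. \<exists>s. P e s)"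
  unfolding ex_list_decode by (rule D11_ex_num)

lemma D11_all_list [D11_intros]: 
  "D11 (\<lambda>e. P (tlN e) (list_decode (hdN e))) \<Longrightarrow> D11 (\<lambda>e. \<forall>s. P e s)"
  unfolding all_list_decode by (rule D11_all_num)

lemma D11_list_tlN: "D11_list t \<Longrightarrow> D11_list (\<lambda>e. t (tlN e))"
  unfolding D11_list_def by (rule D11_num_tlN)

lemma D11_prefix [D11_intros]:
  assumes "D11_list s" "D11_list t" shows "D11 (\<lambda>e. prefix (s e) (t e))"
proof -
  have "prefix a b \<longleftrightarrow> length a \<le> length b \<and> 
      (\<forall>i. i < length a \<longrightarrow> nthc (list_encode a) i = nthc (list_encode b) i)" for a b
  proof
    assume "length a \<le> length b \<and> (\<forall>i. i < length a \<longrightarrow> nthc (list_encode a) i = nthc (list_encode b) i)"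
    then have "a = take (length a) b" by (intro nth_equalityI) auto
    then show "prefix a b" by (metis take_is_prefix)
  qed (auto simp: prefix_def nth_append)
  then show ?thesis
    by (simp only:) (intro D11_intros D11_list_tlN assms)
qed

lemma D11_list_append [D11_intros]:
  assumes "D11_list s" "D11_list t" shows "D11_list (\<lambda>e. s e @ t e)"
proof -
  have "list_encode (a @ b) = n \<longleftrightarrow> prefix a (list_decode n) \<and> length (list_decode n) = length a + length b \<and>
     (\<forall>i. i < length b \<longrightarrow> nthc n (length a + i) = nthc (list_encode b) i)" for a b n
  proof
    assume R: "prefix a (list_decode n) \<and> length (list_decode n) = length a + length b \<and>
     (\<forall>i. i < length b \<longrightarrow> nthc n (length a + i) = nthc (list_encode b) i)"
    then obtain c where c: "list_decode n = a @ c" by (auto simp: prefix_def)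
    then have n: "n = list_encode (a @ c)" by (metis list_decode_inverse)
    from R[unfolded c] have "length c = length b" by simp
    then have "c = b" using R[unfolded c] by (intro nth_equalityI) (auto simp: n)
    with n show "list_encode (a @ b) = n" by simp
  qed auto
  then show ?thesis
    unfolding D11_list_def D11_num_def
    by (simp only:) (intro D11_intros D11_list_tlN assms)
qed

text \<open>The run of a recursion is coded by the sequence of its intermediate values. This
  replaces the recursion by number quantifiers, which the calculus can handle.\<close>

lemma eval_PRec_iff:
  "eval (PRec f g) (n # xs) y \<longleftrightarrow> (\<exists>s. eval f xs (nthc s 0) \<and>
     (\<forall>m. m < n \<longrightarrow> eval g (m # nthc s m # xs) (nthc s (Suc m))) \<and> nthc s n = y)"
proof
  assume "eval (PRec f g) (n # xs) y"
  then have "\<exists>t. length t = Suc n \<and> eval f xs (t ! 0) \<and>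
      (\<forall>m. m < n \<longrightarrow> eval g (m # t ! m # xs) (t ! Suc m)) \<and> t ! n = y"
  proof (induction n arbitrary: y)
    case 0
    then show ?case by (intro exI[of _ "[y]"]) simp
  next
    case (Suc n)
    then obtain r where "eval (PRec f g) (n # xs) r" and g: "eval g (n # r # xs) y" by auto
    with Suc.IH obtain t where t: "length t = Suc n" "eval f xs (t ! 0)" 
      "\<forall>m. m < n \<longrightarrow> eval g (m # t ! m # xs) (t ! Suc m)" "t ! n = r" by blast
    with g show ?case
      by (intro exI[of _ "t @ [y]"]) (auto simp: nth_append less_Suc_eq)
  qed
  then obtain t where t: "length t = Suc n" "eval f xs (t ! 0)"
    "\<forall>m. m < n \<longrightarrow> eval g (m # t ! m # xs) (t ! Suc m)" "t ! n = y" by blast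
  then show "\<exists>s. eval f xs (nthc s 0) \<and>
     (\<forall>m. m < n \<longrightarrow> eval g (m # nthc s m # xs) (nthc s (Suc m))) \<and> nthc s n = y"
    by (intro exI[of _ "list_encode t"]) auto
next
  assume "\<exists>s. eval f xs (nthc s 0) \<and>
     (\<forall>m. m < n \<longrightarrow> eval g (m # nthc s m # xs) (nthc s (Suc m))) \<and> nthc s n = y"
  then obtain s where s: "eval f xs (nthc s 0)"
     "\<forall>m. m < n \<longrightarrow> eval g (m # nthc s m # xs) (nthc s (Suc m))" "nthc s n = y" by blast
  have "m \<le> n \<Longrightarrow> eval (PRec f g) (m # xs) (nthc s m)" for m
    by (induction m) (use s in auto)
  with s show "eval (PRec f g) (n # xs) y" by blast
qed

text \<open>For each fixed term convergence is arithmetical, by induction on the term; a universal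
  machine is not involved. This makes recursively enumerable domains available as atomic
  relations.\<close>

lemma D11_eval:
  assumes "\<forall>s\<in>set ts. D11_num s" "D11_num t"
  shows "D11 (\<lambda>e. eval f (map (\<lambda>s. s e) ts) (t e))"
  using assms
proof (induction f arbitrary: ts t)
  case Zero
  then show ?case by (simp add: D11_intros)
next
  case Succ
  show ?case
  proof (cases "\<exists>s. ts = [s]")
    case True
    with Succ show ?thesis by (auto intro!: D11_intros)
  next
    case False
    then have "\<not> eval Succ (map (\<lambda>s. s e) ts) (t e)" for e by (auto simp: eval_Succ_iff)
    then show ?thesis by (simp add: D11_const)
  qed
next
  case (Proj i)
  then show ?case by (cases "i < length ts") (auto intro!: D11_intros)
next
  case (Comp f gs)
  \<comment> \<open>Generalised for the induction on the inner functions: \<open>us\<close>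
    accumulates the values already computed, each as a new number variable.\<close>
  have "D11 (\<lambda>e. \<exists>ys. list_all2 (\<lambda>g y. eval g (map (\<lambda>s. s e) ts) y) hs ys \<and> eval f (map (\<lambda>s. s e) us @ ys) (t e))"
    if "\<forall>s\<in>set ts. D11_num s" "\<forall>s\<in>set us. D11_num s" "D11_num t" "set hs \<subseteq> set gs" for ts us t hs
    using that
  proof (induction hs arbitrary: ts us t)
    case Nil
    then show ?case using Comp.IH(1)[of us t] by simp
  next
    case (Cons h hs)
    let ?ts = "map (\<lambda>s e. s (tlN e)) ts" and ?us = "map (\<lambda>s e. s (tlN e)) us @ [\<lambda>e. hdN e]"
    have "D11 (\<lambda>e. eval h (map (\<lambda>s. s e) ?ts) (hdN e) \<and>
       (\<exists>ys. list_all2 (\<lambda>g y. eval g (map (\<lambda>s. s e) ?ts) y) hs ys \<and> eval f (map (\<lambda>s. s e) ?us @ ys) (t (tlN e))))"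
      by (intro D11_conj Comp.IH(2) Cons.IH) (use Cons.prems in \<open>auto intro!: D11_num_tlN D11_intros\<close>)
    then have "D11 (\<lambda>e. \<exists>y. eval h (map (\<lambda>s. s e) ts) y \<and>
       (\<exists>ys. list_all2 (\<lambda>g y. eval g (map (\<lambda>s. s e) ts) y) hs ys \<and> eval f ((map (\<lambda>s. s e) us @ [y]) @ ys) (t e)))"
      by (intro D11_ex_num) (simp add: comp_def)
    then show ?case
      by (rule back_subst[of D11]) (auto simp: fun_eq_iff list_all2_Cons1)
  qed
  from this[of ts "[]" t gs] Comp.prems show ?case by (simp add: eval_Comp_iff)
next
  case (PRec f g)
  show ?case
  proof (cases ts)
    case Nil
    then show ?thesis by (simp add: D11_const)
  next
    case (Cons n us)
    let ?us = "map (\<lambda>s e. s (tlN e)) us" 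
    let ?ws = "(\<lambda>e. hdN e) # (\<lambda>e. nthc (hdN (tlN e)) (hdN e)) # map (\<lambda>s e. s (tlN (tlN e))) us"
    have "D11 (\<lambda>e. eval f (map (\<lambda>s. s e) ?us) (nthc (hdN e) 0) \<and>
      (\<forall>m. m < n (tlN e) \<longrightarrow> eval g (map (\<lambda>s. s (consN m e)) ?ws) (nthc (hdN e) (Suc m))) \<and> nthc (hdN e) (n (tlN e)) = t (tlN e))"
    proof (intro D11_conj D11_all_num D11_imp)
      have "D11 (\<lambda>e. eval g (map (\<lambda>s. s e) ?ws) (nthc (hdN (tlN e)) (Suc (hdN e))))"
        by (rule PRec.IH(2)) (use PRec.prems Cons in \<open>auto intro!: D11_num_tlN D11_intros\<close>)
      then show "D11 (\<lambda>e. eval g (map (\<lambda>s. s (consN (hdN e) (tlN e))) ?ws) (nthc (hdN (tlN e)) (Suc (hdN e))))"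
        by (simp add: comp_def)
    qed (intro D11_intros PRec.IH(1) D11_num_tlN | use PRec.prems Cons in \<open>auto intro!: D11_num_tlN D11_intros\<close>)+
    then show ?thesis
      unfolding Cons list.map eval_PRec_iff by (intro D11_ex_num) (simp add: comp_def)
  qed
next
  case (Mu f)
  let ?us = "map (\<lambda>s e. s (tlN (tlN e))) ts"
  have "D11 (\<lambda>e. eval f (map (\<lambda>s. s e) (t # ts)) 0)"
    by (rule Mu.IH) (use Mu.prems in \<open>auto intro!: D11_intros\<close>)
  moreover have "D11 (\<lambda>e. eval f (map (\<lambda>s. s e) ((\<lambda>e. hdN (tlN e)) # ?us)) (hdN e))"
    by (rule Mu.IH) (use Mu.prems in \<open>auto intro!: D11_num_tlN D11_intros\<close>)
  then have "D11 (\<lambda>e. \<forall>m. m < t e \<longrightarrow> (\<exists>y. y > 0 \<and> eval f (m # map (\<lambda>s. s e) ts) y))"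
    by (intro D11_all_num D11_imp D11_ex_num D11_conj D11_intros D11_num_tlN Mu.prems) (simp add: comp_def)
  ultimately show ?case
    unfolding eval_Mu_iff using D11_conj by fastforce
qed

lemma D11_re_domain2 [D11_intros]:
  assumes "D11_num s" "D11_num t" shows "D11 (\<lambda>e. [s e, t e] \<in> re_domain f)"
proof -
  have "D11 (\<lambda>e. eval f (map (\<lambda>s. s e) [\<lambda>e. s (tlN e), \<lambda>e. t (tlN e)]) (hdN e))"
    by (rule D11_eval) (auto intro!: D11_intros D11_num_tlN assms)
  then show ?thesis unfolding re_domain_def by (auto intro!: D11_ex_num)
qed

section \<open>From environments back to the pointclasses\<close>

lemma S11kl_sigma11:
  assumes "S11kl k l P"
  shows "sigma11 k l (\<lambda>as xs. P (\<lambda>i. as ! i, \<lambda>j. xs ! j))"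
proof -
  obtain f where f: "\<And>e. P e \<longleftrightarrow> (\<exists>y. avoids f k l e y)"
    using assms(1) unfolding S11kl_def by blast
  define Q where "Q as ys \<longleftrightarrow> avoids f k l (\<lambda>i. as ! i, \<lambda>j. ys ! Suc j) (ys ! 0)" for as :: "nat list" and ys :: "baire list"
  have "sigma01 k (Suc l) (\<lambda>as ys. \<not> Q as ys)"
    unfolding sigma01_def
  proof (intro exI[of _ f] allI impI)
    fix as :: "nat list" and ys :: "baire list"
    assume l: "length as = k" "length ys = Suc l"
    then have as: "map ((!) as) [0..<k] = as" using map_nth[of as] by blast
    show "\<not> Q as ys \<longleftrightarrow> (\<exists>ss. as @ map list_encode ss \<in> re_domain f \<and> list_all2 (\<lambda>x s. restr x (length s) = s) ys ss)"
    proof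
      assume "\<not> Q as ys"
      then obtain m M where H: "as @ list_encode (restr (ys ! 0) m) # map (\<lambda>j. list_encode (restr (ys ! Suc j) (M j))) [0..<l] \<in> re_domain f"
        unfolding Q_def avoids_def fst_conv snd_conv as by blast
      then show "\<exists>ss. as @ map list_encode ss \<in> re_domain f \<and> list_all2 (\<lambda>x s. restr x (length s) = s) ys ss"
        using l by (intro exI[of _ "restr (ys ! 0) m # map (\<lambda>j. restr (ys ! Suc j) (M j)) [0..<l]"])
          (auto simp: comp_def list_all2_conv_all_nth nth_Cons split: nat.split)
    next
      assume "\<exists>ss. as @ map list_encode ss \<in> re_domain f \<and> list_all2 (\<lambda>x s. restr x (length s) = s) ys ss"
      then obtain ss where ss: "as @ map list_encode ss \<in> re_domain f" "list_all2 (\<lambda>x s. restr x (length s) = s) ys ss" by blast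
      then have "length ss = Suc l" and r: "\<And>i. i < Suc l \<Longrightarrow> restr (ys ! i) (length (ss ! i)) = ss ! i"
        using l by (auto simp: list_all2_conv_all_nth)
      then have "ss = restr (ys ! 0) (length (ss ! 0)) # map (\<lambda>j. restr (ys ! Suc j) (length (ss ! Suc j))) [0..<l]"
        by (intro nth_equalityI) (auto simp: nth_Cons split: nat.split)
      with ss(1) have "as @ list_encode (restr (ys ! 0) (length (ss ! 0))) # map (\<lambda>j. list_encode (restr (ys ! Suc j) (length (ss ! Suc j)))) [0..<l] \<in> re_domain f"
        by (metis (no_types, lifting) list.simps(9) map_map comp_apply map_cong)
      then show "\<not> Q as ys"
        unfolding Q_def avoids_def fst_conv snd_conv as
        by (intro notI) (drule spec[of _ "length (ss ! 0)"], drule spec[of _ "\<lambda>j. length (ss ! Suc j)"], simp)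
    qed
  qed
  then show ?thesis
    unfolding sigma11_def pi01_def f
    by (intro exI[of _ Q] conjI) (auto simp: Q_def)
qed

text \<open>\<open>S11\<close> does not record how many variables occur. Surplus function variables
  are removed by vacuous quantification; a fresh number variable is added each time because
  \<open>S11kl_all_ex\<close> consumes one. Surplus number variables are finally identified with
  variable 1.\<close>

lemma S11kl_2_0:
  assumes "S11kl k l P" "\<And>e e'. fst e 0 = fst e' 0 \<Longrightarrow> fst e 1 = fst e' 1 \<Longrightarrow> P e = P e'"
  shows "S11kl 2 0 P"
  using assms(1)
proof (induction l arbitrary: k)
  case 0
  have "S11kl 2 0 (\<lambda>e. P (fst e \<circ> (\<lambda>i. if i = 0 then 0 else 1), snd e \<circ> id))"
    by (rule S11kl_rename[OF 0]) auto
  moreover have "P (fst e \<circ> (\<lambda>i. if i = 0 then 0 else 1), snd e \<circ> id) = P e" for e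
    by (rule assms(2)) auto
  ultimately show ?case by simp
next
  case (Suc l)
  have "S11kl (Suc k) (Suc l) (\<lambda>e. P (fst e \<circ> Suc, snd e \<circ> id))"
    by (rule S11kl_rename[OF Suc.prems]) auto
  from S11kl_all_ex[OF this] have "S11kl k l (\<lambda>e. \<forall>p. \<exists>z. P (fst (consN p (consF z e)) \<circ> Suc, snd (consN p (consF z e)) \<circ> id))" .
  moreover have "P (fst (consN p (consF z e)) \<circ> Suc, snd (consN p (consF z e)) \<circ> id) = P e" for p z e
    by (rule assms(2)) (auto simp: consN_def consF_def)
  ultimately have "S11kl k l P" by simp
  then show ?case by (rule Suc.IH)
qed

lemma delta11_point_graph:
  assumes "D11 (\<lambda>e. x (hdN e) = hdN (tlN e))"
  shows "delta11_point x"
proof -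
  let ?P = "\<lambda>e :: env. x (fst e 0) = fst e 1"
  have "D11 ?P" using assms by (simp add: hdN_def tlN_def)
  then obtain k l k' l' where "S11kl k l ?P" "S11kl k' l' (\<lambda>e. \<not> ?P e)"
    unfolding D11_def S11_def by blast
  then have "S11kl 2 0 ?P" "S11kl 2 0 (\<lambda>e. \<not> ?P e)"
    by (auto intro: S11kl_2_0)
  from this[THEN S11kl_sigma11] show ?thesis
    by (simp add: delta11_point_def delta11_def pi11_def)
qed

lemma delta11_point_indicator:
  assumes "D11 (\<lambda>e. hdN e \<in> X)"
  shows "delta11_point (\<lambda>c. if c \<in> X then 1 else 0)"
proof (rule delta11_point_graph)
  have "D11 (\<lambda>e. (hdN e \<in> X \<and> hdN (tlN e) = 1) \<or> (\<not> hdN e \<in> X \<and> hdN (tlN e) = 0))"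
    by (intro D11_intros assms)
  then show "D11 (\<lambda>e. (if hdN e \<in> X then 1 else 0) = hdN (tlN e))"
    by (rule back_subst[of D11]) auto
qed

lemma delta11_point_set_seq_code:
  assumes "D11 (\<lambda>e. list_decode (hdN e) \<in> Ts (hdN (tlN e)))"
  shows "delta11_point (set_seq_code Ts)"
proof -
  let ?X = "{c. list_decode (snd (prod_decode c)) \<in> Ts (fst (prod_decode c))}"
  have "D11 (\<lambda>e. list_decode (snd (prod_decode (hdN e))) \<in> Ts (fst (prod_decode (hdN e))))"
    by (rule D11_subst2[where P = "\<lambda>_ n c. list_decode c \<in> Ts n", OF assms]) (intro D11_intros)+
  then have "D11 (\<lambda>e. hdN e \<in> ?X)" by simp
  from delta11_point_indicator[OF this] show ?thesis
    by (rule back_subst[of delta11_point]) (auto simp: fun_eq_iff set_seq_code_def set_code_def split: prod.split)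
qed

lemma delta11_point_set_code:
  assumes "D11 (\<lambda>e. list_decode (hdN e) \<in> Ts (hdN (tlN e)))"
  shows "delta11_point (set_code (Ts n))"
proof -
  have "D11 (\<lambda>e. hdN e \<in> {c. list_decode c \<in> Ts n})"
    using D11_subst2[where P = "\<lambda>_ n c. list_decode c \<in> Ts n" and s = "\<lambda>e. n", OF assms D11_num_const D11_num_hdN[OF renaming_id]]
    by simp
  from delta11_point_indicator[OF this] show ?thesis
    by (simp add: set_code_def)
qed

lemma sigma11_0_1:
  assumes "sigma11 0 1 P"
  obtains f where "\<And>x. P [] [x] \<longleftrightarrow> (\<exists>y. \<forall>m M. [list_encode (restr y m), list_encode (restr x M)] \<notin> re_domain f)"
proof -
  obtain Q where Q: "pi01 0 (Suc 1) Q" "\<And>x. P [] [x] \<longleftrightarrow> (\<exists>y. Q [] [y, x])"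
    using assms unfolding sigma11_def by fastforce
  then obtain f where f: "\<And>xs. length xs = Suc 1 \<Longrightarrow> \<not> Q [] xs \<longleftrightarrow>
      (\<exists>ss. map list_encode ss \<in> re_domain f \<and> list_all2 (\<lambda>x s. restr x (length s) = s) xs ss)"
    unfolding pi01_def sigma01_def by fastforce
  have "Q [] [y, x] \<longleftrightarrow> (\<forall>m M. [list_encode (restr y m), list_encode (restr x M)] \<notin> re_domain f)" for x y
  proof -
    have "\<not> Q [] [y, x] \<longleftrightarrow> (\<exists>s t. [list_encode s, list_encode t] \<in> re_domain f \<and> restr y (length s) = s \<and> restr x (length t) = t)"
    proof
      assume "\<exists>s t. [list_encode s, list_encode t] \<in> re_domain f \<and> restr y (length s) = s \<and> restr x (length t) = t"
      then obtain s t where "[list_encode s, list_encode t] \<in> re_domain f" "restr y (length s) = s" "restr x (length t) = t"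
        by blast
      then show "\<not> Q [] [y, x]"
        by (subst f, simp) (intro exI[of _ "[s, t]"], simp)
    next
      assume "\<not> Q [] [y, x]"
      then show "\<exists>s t. [list_encode s, list_encode t] \<in> re_domain f \<and> restr y (length s) = s \<and> restr x (length t) = t"
        by (subst (asm) f, simp) (force simp: list_all2_Cons1)
    qed
    then show ?thesis by (metis restr_simps(1))
  qed
  with Q(2) that show thesis by simp
qed

section \<open>Stage comparison in open games\<close>

text \<open>In position \<open>p\<close> the first player chooses \<open>i\<close> and the second
  answers with some \<open>p'\<close> such that \<open>E p i p'\<close>. The first player wins once
  there is no answer.\<close>

locale open_game =
  fixes E :: "'p \<Rightarrow> 'i \<Rightarrow> 'p \<Rightarrow> bool"
begin

definition forced :: "'p set \<Rightarrow> 'p set" where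
  "forced X = {p. \<exists>i. \<forall>p'. E p i p' \<longrightarrow> p' \<in> X}"

text \<open>The transfinite iterates of \<open>forced\<close>, starting from the empty set
  (\<open>C = {}\<close>). Taking unions over arbitrary sets of earlier stages stands in for
  recursion on ordinals.\<close>

inductive stage :: "'p set \<Rightarrow> bool" where
  stageI: "\<forall>Y\<in>C. stage Y \<Longrightarrow> stage (\<Union>Y\<in>C. forced Y)"

definition won :: "'p \<Rightarrow> bool" where
  "won p \<longleftrightarrow> (\<exists>X. stage X \<and> p \<in> X)"

text \<open>The largest stage that misses \<open>q\<close>: the positions won strictly earlier than
  \<open>q\<close>, or all won positions if \<open>q\<close> is not won.\<close>

definition before :: "'p \<Rightarrow> 'p set" where
  "before q = \<Union>{X. stage X \<and> q \<notin> X}"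

text \<open>The stage following \<open>before q\<close>: it consists of the won positions whose rank
  is at most that of \<open>q\<close>, where a position that is not won counts as having infinite
  rank.\<close>

definition no_later :: "'p \<Rightarrow> 'p \<Rightarrow> bool" where
  "no_later p q \<longleftrightarrow> p \<in> forced (before q)"

lemma forced_mono: "X \<subseteq> Y \<Longrightarrow> forced X \<subseteq> forced Y"
  unfolding forced_def by blast

lemma stage_subset_forced: "stage X \<Longrightarrow> X \<subseteq> forced X"
proof (induction rule: stage.induct)
  case (stageI C)
  have "forced Y \<subseteq> forced (\<Union>Y\<in>C. forced Y)" if "Y \<in> C" for Y
    using stageI that by (intro forced_mono) blast
  then show ?case by blast
qed

lemma stage_forced: "stage X \<Longrightarrow> stage (forced X)"
  using stageI[of "{X}"] by simp

lemma stage_Union: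
  assumes "\<forall>X\<in>A. stage X" shows "stage (\<Union>A)"
proof -
  have "(\<Union>Y\<in>{Y. stage Y \<and> forced Y \<subseteq> \<Union>A}. forced Y) = \<Union>A"
  proof
    show "\<Union>A \<subseteq> (\<Union>Y\<in>{Y. stage Y \<and> forced Y \<subseteq> \<Union>A}. forced Y)"
    proof
      fix x assume "x \<in> \<Union>A"
      then obtain X where X: "X \<in> A" "x \<in> X" by blast
      with assms have "stage X" by blast
      then obtain C where "X = (\<Union>Y\<in>C. forced Y)" "\<forall>Y\<in>C. stage Y" by (auto elim: stage.cases)
      with X show "x \<in> (\<Union>Y\<in>{Y. stage Y \<and> forced Y \<subseteq> \<Union>A}. forced Y)" by blast
    qed
  qed blast
  then show ?thesis using stageI[of "{Y. stage Y \<and> forced Y \<subseteq> \<Union>A}"] by simp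
qed

lemma forced_subset_stage:
  assumes "\<forall>Y\<in>C. stage Y" "Y \<in> C" shows "Y \<subseteq> (\<Union>Y\<in>C. forced Y)"
  using assms stage_subset_forced[of Y] by (meson SUP_upper order_trans)

text \<open>No stage lies strictly between \<open>X\<close> and \<open>forced X\<close>, shown by
  nested induction as for towers in Zermelo's well-ordering argument. Both orientations are carried
  along because together they force equality when neither successor is included.\<close>

lemma stage_linear: "stage Y \<Longrightarrow> stage X \<Longrightarrow> (forced X \<subseteq> Y \<or> Y \<subseteq> X) \<and> (forced Y \<subseteq> X \<or> X \<subseteq> Y)"
proof (induction Y arbitrary: X rule: stage.induct)
  case (stageI D)
  define Y where "Y = (\<Union>Z\<in>D. forced Z)"
  have stD: "\<forall>Z\<in>D. stage Z" using stageI.IH unfolding ball_conj_distrib by (rule conjunct1)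
  have IH: "forced X \<subseteq> Z \<or> Z \<subseteq> X" "forced Z \<subseteq> X \<or> X \<subseteq> Z" if "Z \<in> D" "stage X" for Z X
    using bspec[OF stageI.IH that(1)] that(2) by metis+
  have 1: "forced X \<subseteq> Y \<or> Y \<subseteq> X" if X: "stage X" for X
  proof (cases "\<exists>Z\<in>D. forced X \<subseteq> Z")
    case True
    then show ?thesis using forced_subset_stage[OF stD] unfolding Y_def by (meson order_trans)
  next
    case no: False
    have "forced Z \<subseteq> X \<or> forced X \<subseteq> Y" if Z: "Z \<in> D" for Z
    proof (cases "forced Z \<subseteq> X")
      case False
      \<comment> \<open>Both successor inclusions are excluded, so the hypothesis leaves inclusion
        in both directions.\<close>
      with IH[OF Z X] no Z have "X = Z" by auto
      with Z show ?thesis unfolding Y_def by (simp add: SUP_upper)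
    qed simp
    then show ?thesis unfolding Y_def by (meson UN_least)
  qed
  have 2: "forced Y \<subseteq> X \<or> X \<subseteq> Y" if "stage X" for X
    using that
  proof (induction X rule: stage.induct)
    case (stageI C)
    have stC: "\<forall>V\<in>C. stage V" using stageI.IH unfolding ball_conj_distrib by (rule conjunct1)
    have IH': "forced Y \<subseteq> V \<or> V \<subseteq> Y" if "V \<in> C" for V
      using bspec[OF stageI.IH that] by metis
    show ?case
    proof (cases "\<exists>V\<in>C. forced Y \<subseteq> V")
      case True
      then show ?thesis using forced_subset_stage[OF stC] by (meson order_trans)
    next
      case no: False
      have "forced V \<subseteq> Y \<or> forced Y \<subseteq> (\<Union>V\<in>C. forced V)" if V: "V \<in> C" for V
      proof (cases "forced V \<subseteq> Y")
        case False
        with IH'[OF V] 1[of V] no V stC have "V = Y" by auto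
        with V show ?thesis by (simp add: SUP_upper)
      qed simp
      then show ?thesis by (meson UN_least)
    qed
  qed
  show ?case using 1 2 stageI.prems unfolding Y_def by blast
qed

lemma stage_total: "stage X \<Longrightarrow> stage Y \<Longrightarrow> X \<subseteq> Y \<or> Y \<subseteq> X"
  using stage_linear stage_subset_forced by blast

lemma stage_before: "stage (before q)"
  unfolding before_def by (rule stage_Union) simp

lemma not_before_self: "q \<notin> before q"
  unfolding before_def by blast

lemma subset_before: "stage X \<Longrightarrow> q \<notin> X \<Longrightarrow> X \<subseteq> before q"
  unfolding before_def by blast

lemma before_subset: "stage X \<Longrightarrow> q \<in> forced X \<Longrightarrow> before q \<subseteq> X"
  using stage_linear[OF stage_before, of X q] not_before_self by blast

text \<open>If \<open>q\<close> enters at \<open>forced Y\<close> and not already at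
  \<open>Y\<close>, then \<open>Y\<close> is contained in \<open>before q\<close>, and
  \<open>forced\<close> is monotone.\<close>

lemma won_iff: "won q \<longleftrightarrow> q \<in> forced (before q)"
proof
  have "q \<in> X \<Longrightarrow> q \<in> forced (before q)" if "stage X" for X
    using that
  proof (induction rule: stage.induct)
    case (stageI C)
    then obtain Y where Y: "Y \<in> C" "stage Y" "q \<in> forced Y" "q \<in> Y \<Longrightarrow> q \<in> forced (before q)" by blast
    then show ?case using forced_mono subset_before by blast
  qed
  then show "won q \<Longrightarrow> q \<in> forced (before q)" unfolding won_def by blast
qed (auto simp: won_def intro: stage_forced stage_before)

lemma won_before: "p \<in> before q \<Longrightarrow> won p"
  unfolding won_def using stage_before by blast

lemma no_later_won: "no_later p q \<Longrightarrow> won p"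
  unfolding no_later_def won_def using stage_forced stage_before by blast

lemma no_later_iff_not_before:
  assumes "won p" shows "no_later p q \<longleftrightarrow> q \<notin> before p"
proof
  assume "no_later p q"
  then have "before p \<subseteq> before q" unfolding no_later_def using before_subset stage_before by blast
  then show "q \<notin> before p" using not_before_self by blast
next
  assume "q \<notin> before p"
  then have "before p \<subseteq> before q" using subset_before stage_before by blast
  then show "no_later p q" unfolding no_later_def using assms won_iff forced_mono by blast
qed

lemma before_iff_not_no_later:
  assumes "won p" shows "p \<in> before q \<longleftrightarrow> \<not> no_later q p"
proof
  assume "p \<in> before q"
  then show "\<not> no_later q p" unfolding no_later_def using before_subset stage_before not_before_self by blast
next
  have p: "p \<in> forced (before p)" using assms won_iff by simp
  assume "\<not> no_later q p"
  then have "forced (before p) \<subseteq> before q"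
    unfolding no_later_def by (intro subset_before stage_forced stage_before)
  with p show "p \<in> before q" by blast
qed

text \<open>For won \<open>p\<close> the right side says that no move at \<open>q\<close> wins as
  early as \<open>p\<close>, that is, \<open>no_later q p\<close> fails. If \<open>p\<close> is not
  won, both sides fail, the right one because there is at least one \<open>i\<close>.\<close>

lemma before_iff_response: "p \<in> before q \<longleftrightarrow> (\<forall>i. \<exists>q'. E q i q' \<and> no_later p q')"
proof (cases "won p")
  case True
  have "(\<forall>i. \<exists>q'. E q i q' \<and> no_later p q') \<longleftrightarrow> \<not> no_later q p"
    unfolding no_later_def[of q p] forced_def using no_later_iff_not_before[OF True] by blast
  then show ?thesis using before_iff_not_no_later[OF True] by simp
next
  case False
  then show ?thesis using won_before no_later_won by blast
qed

text \<open>One round of the game unfolded in both arguments: that each result \<open>p'\<close> is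
  won strictly before \<open>q\<close> is again expressed by the relation, through
  \<open>before_iff_response\<close>. Stages have disappeared, which makes the condition
  arithmetical for an arithmetical game on numbers.\<close>

definition comparison :: "('p \<Rightarrow> 'p \<Rightarrow> bool) \<Rightarrow> bool" where
  "comparison R \<longleftrightarrow> (\<forall>p q. R p q \<longleftrightarrow>
     (\<exists>i. \<forall>p'. E p i p' \<longrightarrow> (\<forall>i'. \<exists>q'. E q i' q' \<and> R p' q')))"

lemma comparison_no_later: "comparison no_later"
  unfolding comparison_def before_iff_response[symmetric] by (simp add: no_later_def forced_def)

text \<open>On the won positions the recursion for \<open>no_later\<close> is well-founded, so it has only one solution
  there. This makes stage comparison \<open>\<Delta>\<^sup>1\<^sub>1\<close>, although the set of won positions is only \<open>\<Pi>\<^sup>1\<^sub>1\<close>.\<close>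

lemma comparison_unique:
  assumes R: "comparison R" and won: "won p \<or> won q"
  shows "R p q \<longleftrightarrow> no_later p q"
proof -
  have Rpq: "R p q \<longleftrightarrow> (\<exists>i. \<forall>p'. E p i p' \<longrightarrow> (\<forall>i'. \<exists>q'. E q i' q' \<and> R p' q'))" for p q
    using R unfolding comparison_def by blast
  \<comment> \<open>One implication goes by induction on the stage of \<open>p\<close>, the other by
    induction on the stage of \<open>q\<close>, each for all values of the other position.\<close>
  have 1: "\<forall>p\<in>X. \<forall>q. no_later p q \<longrightarrow> R p q" if "stage X" for X
    using that
  proof (induction rule: stage.induct)
    case (stageI C)
    show ?case
    proof (intro ballI allI impI)
      fix p q assume p: "p \<in> (\<Union>Y\<in>C. forced Y)" and L: "no_later p q"
      then obtain Y where Y: "stage Y" "p \<in> forced Y" and IH: "\<forall>p\<in>Y. \<forall>q. no_later p q \<longrightarrow> R p q"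
        using stageI by blast
      \<comment> \<open>Stages are comparable, so the intersection is one of the two and a single
        move serves both.\<close>
      have "p \<in> forced (Y \<inter> before q)"
        using stage_total[OF Y(1) stage_before] Y(2) L unfolding no_later_def
        by (metis inf.absorb1 inf.absorb2)
      then obtain i where i: "\<And>p'. E p i p' \<Longrightarrow> p' \<in> Y" "\<And>p'. E p i p' \<Longrightarrow> p' \<in> before q"
        unfolding forced_def by blast
      show "R p q"
        unfolding Rpq[of p q] using i IH unfolding before_iff_response by blast
    qed
  qed
  have 2: "\<forall>q\<in>X. \<forall>p. R p q \<longrightarrow> no_later p q" if "stage X" for X
    using that
  proof (induction rule: stage.induct)
    case (stageI C)
    show ?case
    proof (intro ballI allI impI)
      fix q p assume q: "q \<in> (\<Union>Y\<in>C. forced Y)" and Rq: "R p q"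
      then obtain Y where Y: "stage Y" "q \<in> forced Y" and IH: "\<forall>q\<in>Y. \<forall>p. R p q \<longrightarrow> no_later p q"
        using stageI by blast
      have "won q" unfolding won_def using Y stage_forced by blast
      \<comment> \<open>The winning move at \<open>q\<close> is inserted into the recursion for
        \<open>R\<close>. All answers to it come before \<open>q\<close>, where the induction
        hypothesis applies.\<close>
      then obtain i' where i': "\<And>q'. E q i' q' \<Longrightarrow> q' \<in> before q"
        unfolding won_iff forced_def by blast
      have bY: "before q \<subseteq> Y" using before_subset Y by blast
      from Rq obtain i where i: "\<And>p'. E p i p' \<Longrightarrow> \<exists>q'. E q i' q' \<and> R p' q'"
        unfolding Rpq[of p q] by blast
      have "p' \<in> before q" if p': "E p i p'" for p'
      proof -
        obtain q' where q': "E q i' q'" "R p' q'" using i[OF p'] by blast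
        with i' bY IH have L: "no_later p' q'" "q' \<in> before q" by blast+
        have "\<not> no_later q q'" using before_iff_not_no_later won_before L(2) by blast
        moreover have "before p' \<subseteq> before q'"
          using L(1) unfolding no_later_def by (intro before_subset stage_before)
        ultimately have "\<not> no_later q p'" unfolding no_later_def using forced_mono by blast
        then show ?thesis using before_iff_not_no_later no_later_won L(1) by blast
      qed
      then show "no_later p q" unfolding no_later_def forced_def by blast
    qed
  qed
  show ?thesis
  proof (cases "won q")
    case True
    then show ?thesis using 1 2 no_later_won unfolding won_def by blast
  next
    case False
    \<comment> \<open>Only \<open>p\<close> is won, so \<open>no_later p q\<close> holds outright
      and the first implication suffices.\<close>
    with won have "won p" by blast
    moreover have "before p \<subseteq> before q"
      using False by (intro subset_before stage_before) (auto intro: won_before)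
    ultimately have "no_later p q" unfolding no_later_def using won_iff forced_mono by blast
    then show ?thesis using 1 no_later_won unfolding won_def by blast
  qed
qed

text \<open>The won positions form the union of all stages, hence a stage, hence a set closed under
  \<open>forced\<close>.\<close>

lemma not_won_response:
  assumes "\<not> won p" shows "\<exists>p'. E p i p' \<and> \<not> won p'"
proof (rule ccontr)
  assume "\<not> ?thesis"
  then have "p \<in> forced {p. won p}" unfolding forced_def by blast
  moreover have "{p. won p} = \<Union>{X. stage X}" unfolding won_def by blast
  then have "stage {p. won p}" using stage_Union by simp
  ultimately show False using assms stage_forced unfolding won_def by blast
qed

text \<open>Replaces the choice of a least rank along a sequence: descend to an earlier stage as
  long as it still contains a member of the sequence.\<close>

lemma won_minimal:
  assumes "won (u n)" shows "\<exists>n. won (u n) \<and> (\<forall>m. u m \<notin> before (u n))"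
proof -
  have "\<exists>n. u n \<in> X \<Longrightarrow> ?thesis" if "stage X" for X
    using that
  proof (induction rule: stage.induct)
    case (stageI C)
    then obtain n Y where Y: "Y \<in> C" "stage Y" "u n \<in> forced Y" by blast
    show ?case
    proof (cases "\<exists>m. u m \<in> Y")
      case True
      with stageI.IH Y(1) show ?thesis by blast
    next
      case False
      have "won (u n)" unfolding won_def using Y stage_forced by blast
      moreover have "before (u n) \<subseteq> Y" using before_subset Y by blast
      ultimately show ?thesis using False by blast
    qed
  qed
  with assms show ?thesis unfolding won_def by blast
qed

lemma before_move: "p \<in> before q \<Longrightarrow> \<exists>i. \<forall>p'. E p i p' \<longrightarrow> p' \<in> before q"
  using stage_subset_forced[OF stage_before, of q] unfolding forced_def by blast

text \<open>Playing \<open>i\<close> forever along \<open>c\<close> never ends the play, so it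
  cannot be the winning strategy: somewhere on the path the first player wins by another move. It
  will be used with \<open>i = 0\<close>, asking for digits, so that \<open>j\<close> is a demand
  for an extension.\<close>

lemma stage_path:
  assumes "stage X" "c n \<in> X" "\<And>n. E (c n) i (c (Suc n))"
  shows "\<exists>n j. j \<noteq> i \<and> (\<forall>p'. E (c n) j p' \<longrightarrow> p' \<in> X)"
  using assms(1,2)
proof (induction arbitrary: n rule: stage.induct)
  case (stageI C)
  then obtain Y where Y: "Y \<in> C" "c n \<in> forced Y" by blast
  then obtain j where j: "\<And>p'. E (c n) j p' \<Longrightarrow> p' \<in> Y" unfolding forced_def by blast
  have sub: "Y \<subseteq> (\<Union>Y\<in>C. forced Y)" 
    using stageI.IH Y(1) by (intro forced_subset_stage) auto
  show ?case
  proof (cases "j = i")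
    case True
    with j assms(3) have "c (Suc n) \<in> Y" by blast
    then obtain n j where nj: "j \<noteq> i" "\<forall>p'. E (c n) j p' \<longrightarrow> p' \<in> Y"
      using bspec[OF stageI.IH Y(1)] by metis
    with sub show ?thesis by (metis subsetD)
  next
    case False
    with j sub show ?thesis by blast
  qed
qed

end

section \<open>Topology of Baire space\<close>

lemma open_agree: "open {y :: baire. restr y m = restr x m}"
proof -
  have "open ((\<lambda>y :: baire. y i) -` {x i})" for i
    by (intro open_vimage open_discrete continuous_on_product_coordinates)
  then have "open (\<Inter>i\<in>{..<m}. (\<lambda>y :: baire. y i) -` {x i})" by (intro open_INT) auto
  moreover have "{y. restr y m = restr x m} = (\<Inter>i\<in>{..<m}. (\<lambda>y :: baire. y i) -` {x i})"
    unfolding restr_def map_eq_conv by auto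
  ultimately show ?thesis by simp
qed

lemma restr_eq_mono: "restr x n = restr y n \<Longrightarrow> m \<le> n \<Longrightarrow> restr x m = restr y m"
  by (simp add: restr_def)

lemma open_contains_agree:
  assumes "open U" "x \<in> U" obtains m where "{y :: baire. restr y m = restr x m} \<subseteq> U"
proof -
  obtain X where X: "x \<in> (\<Pi>\<^sub>E i\<in>UNIV. X i)" "finite {i. X i \<noteq> UNIV}" "(\<Pi>\<^sub>E i\<in>UNIV. X i) \<subseteq> U"
    using product_topology_open_contains_basis[of "\<lambda>_. euclidean" UNIV U x] assms
    unfolding open_fun_def by auto
  obtain m where m: "\<forall>i\<in>{i. X i \<noteq> UNIV}. i < m"
    using X(2) by (meson finite_nat_set_iff_bounded)
  have "y \<in> (\<Pi>\<^sub>E i\<in>UNIV. X i)" if "restr y m = restr x m" for y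
  proof -
    have "y i \<in> X i" for i
    proof (cases "i < m")
      case True
      with that have "y i = x i" by (simp add: restr_def)
      with X(1) show ?thesis by auto
    qed (use m in auto)
    then show ?thesis by auto
  qed
  then have "{y. restr y m = restr x m} \<subseteq> U"
    using subsetD[OF X(3)] by (intro subsetI) simp
  then show thesis by (rule that)
qed

lemma continuous_on_baire:
  fixes F :: "baire \<Rightarrow> baire"
  assumes "\<And>x n. x \<in> X \<Longrightarrow> \<exists>m. \<forall>y\<in>X. restr y m = restr x m \<longrightarrow> restr (F y) n = restr (F x) n"
  shows "continuous_on X F"
  unfolding continuous_on_topological
proof (intro ballI allI impI)
  fix x B assume "x \<in> X" "open B" "F x \<in> B"
  obtain n where n: "{y. restr y n = restr (F x) n} \<subseteq> B"
    using open_contains_agree[OF \<open>open B\<close> \<open>F x \<in> B\<close>] by blast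
  obtain m where "\<forall>y\<in>X. restr y m = restr x m \<longrightarrow> restr (F y) n = restr (F x) n"
    using assms[OF \<open>x \<in> X\<close>] by blast
  with n show "\<exists>A. open A \<and> x \<in> A \<and> (\<forall>y\<in>X. y \<in> A \<longrightarrow> F y \<in> B)"
    by (intro exI[of _ "{y. restr y m = restr x m}"]) (auto simp: open_agree)
qed

lemma closedin_baire:
  fixes A :: "baire set"
  assumes "Y \<subseteq> A" "\<And>z. z \<in> A \<Longrightarrow> \<forall>m. \<exists>y\<in>Y. restr y m = restr z m \<Longrightarrow> z \<in> Y"
  shows "closedin (top_of_set A) Y"
proof -
  let ?C = "{z. \<forall>m. \<exists>y\<in>Y. restr y m = restr z m}"
  have "open (- ?C)"
  proof (subst open_subopen, intro ballI)
    fix z assume "z \<in> - ?C"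
    then obtain m where m: "\<forall>y\<in>Y. restr y m \<noteq> restr z m" by auto
    have "w \<in> - ?C" if "restr w m = restr z m" for w
    proof
      assume "w \<in> ?C"
      then obtain y where "y \<in> Y" "restr y m = restr w m" by blast
      with m that show False by simp
    qed
    then have "{y. restr y m = restr z m} \<subseteq> - ?C" by (intro subsetI) simp
    then show "\<exists>T. open T \<and> z \<in> T \<and> T \<subseteq> - ?C"
      by (intro exI[of _ "{y. restr y m = restr z m}"] conjI open_agree) simp
  qed
  then have "closed ?C" by (simp add: closed_def)
  moreover have "Y = A \<inter> ?C" using assms by blast
  ultimately show ?thesis by (auto simp: closedin_closed)
qed

text \<open>The body is closed and lies in the product of the sets of digits that occur at each
  level; these are finite, so Tychonoff's theorem applies.\<close>

lemma compact_body:
  assumes "compact_tree T" shows "compact (body T)"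
proof -
  have tree: "is_tree T" and fin: "\<And>s. s \<in> T \<Longrightarrow> finite {n. s @ [n] \<in> T}"
    using assms by (auto simp: compact_tree_def)
  have level: "finite {s \<in> T. length s = n}" for n
  proof (induction n)
    case 0
    have "{s \<in> T. length s = 0} \<subseteq> {[]}" by auto
    then show ?case using finite_subset by blast
  next
    case (Suc n)
    have "{s \<in> T. length s = Suc n} \<subseteq> (\<Union>s\<in>{s \<in> T. length s = n}. (\<lambda>k. s @ [k]) ` {k. s @ [k] \<in> T})"
    proof
      fix s assume s: "s \<in> {s \<in> T. length s = Suc n}"
      then obtain s' k where s': "s = s' @ [k]" by (metis (mono_tags) length_Suc_conv_rev mem_Collect_eq)
      with s tree have "s' \<in> T" unfolding is_tree_def by (metis (mono_tags) mem_Collect_eq prefixI)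
      with s s' show "s \<in> (\<Union>s\<in>{s \<in> T. length s = n}. (\<lambda>k. s @ [k]) ` {k. s @ [k] \<in> T})" by auto
    qed
    moreover have "finite (\<Union>s\<in>{s \<in> T. length s = n}. (\<lambda>k. s @ [k]) ` {k. s @ [k] \<in> T})"
      using Suc fin by auto
    ultimately show ?case by (rule finite_subset)
  qed
  let ?K = "\<Pi>\<^sub>E i\<in>UNIV. (\<lambda>s. s ! i) ` {s \<in> T. length s = Suc i}"
  have "compactin (product_topology (\<lambda>_. euclidean) UNIV) ?K"
    unfolding compactin_PiE using level by (auto intro!: finite_imp_compact finite_imageI)
  then have K: "compact ?K"
    by (simp add: euclidean_product_topology)
  have C: "closed (body T)"
    unfolding closed_def
  proof (subst open_subopen, intro ballI)
    fix z assume "z \<in> - body T"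
    then obtain m where m: "restr z m \<notin> T" by (auto simp: body_def)
    have "w \<in> - body T" if "restr w m = restr z m" for w
    proof
      assume "w \<in> body T"
      then have "restr w m \<in> T" by (simp add: body_def)
      with m that show False by simp
    qed
    then have "{y. restr y m = restr z m} \<subseteq> - body T" by (intro subsetI) simp
    then show "\<exists>U. open U \<and> z \<in> U \<and> U \<subseteq> - body T"
      by (intro exI[of _ "{y. restr y m = restr z m}"] conjI open_agree) simp
  qed
  have sub: "body T \<subseteq> ?K"
  proof
    fix x assume "x \<in> body T"
    then have "restr x (Suc i) \<in> {s \<in> T. length s = Suc i}" "x i = restr x (Suc i) ! i" for i
      by (auto simp: body_def restr_def simp del: upt_Suc)
    then show "x \<in> ?K" by blast
  qed
  show ?thesis using compact_Int_closed[OF K C] unfolding inf.absorb2[OF sub] .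
qed

text \<open>The \<open>n\<close>-th coordinate of the homeomorphism is bounded by \<open>b n\<close>
  on the compact set \<open>Y \<inter> K n\<close>. The preimage of the sequence of all
  \<open>Suc (b n)\<close> therefore lies in no \<open>K n\<close>.\<close>

lemma not_sigma_compact_baire:
  fixes Y :: "baire set"
  assumes "Y homeomorphic (UNIV :: baire set)" "closedin (top_of_set A) Y"
    and "\<And>n :: nat. compact (K n)" "A = (\<Union>n. K n)"
  shows False
proof -
  obtain f g where fg: "homeomorphism Y (UNIV :: baire set) f g"
    using assms(1) unfolding homeomorphic_def by blast
  have "\<exists>b. \<forall>y\<in>Y \<inter> K n. f y n \<le> b" for n
  proof -
    obtain C where C: "closed C" "Y = A \<inter> C"
      using assms(2) by (auto simp: closedin_closed)
    have "Y \<inter> K n = K n \<inter> C" using C assms(4) by blast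
    with C have "compact (Y \<inter> K n)" using assms(3) by (simp add: compact_Int_closed)
    moreover have "continuous_on (Y \<inter> K n) (\<lambda>y. f y n)"
      using fg unfolding homeomorphism_def
      by (auto intro: continuous_on_product_then_coordinatewise continuous_on_subset)
    ultimately have "compact ((\<lambda>y. f y n) ` (Y \<inter> K n))" by (rule compact_continuous_image[rotated])
    then obtain C' where "finite C'" "(\<lambda>y. f y n) ` (Y \<inter> K n) \<subseteq> (\<Union>k\<in>C'. {k})"
      by (rule compactE_image[of _ UNIV "\<lambda>k. {k}"]) (auto simp: open_discrete)
    then have "f y n \<le> Max C'" if "y \<in> Y \<inter> K n" for y
      using that by (intro Max_ge) auto
    then show ?thesis by blast
  qed
  then obtain b where b: "\<And>n y. y \<in> Y \<inter> K n \<Longrightarrow> f y n \<le> b n" by metis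
  obtain y where y: "y \<in> Y" "f y = (\<lambda>n. Suc (b n))"
    using fg unfolding homeomorphism_def by (metis UNIV_I imageE)
  have "Y \<subseteq> A" using assms(2) closedin_imp_subset by fastforce
  with y assms(4) obtain n where "y \<in> K n" by blast
  with b[of y n] y show False by auto
qed

section \<open>The Hurewicz game\<close>

definition ini :: "nat list \<Rightarrow> baire \<Rightarrow> bool" where
  "ini s x \<longleftrightarrow> restr x (length s) = s"

lemma ini_iff_nth: "ini s x \<longleftrightarrow> (\<forall>i<length s. s ! i = x i)"
  unfolding ini_def list_eq_iff_nth_eq[of "restr x (length s)" s] by (auto simp: restr_def)

lemma ini_restr: "ini (restr x m) x"
  by (simp add: ini_def)

lemma ini_prefix: "prefix s s' \<Longrightarrow> ini s' x \<Longrightarrow> ini s x"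
  unfolding ini_iff_nth by (metis nth_append order_less_le_trans prefixE prefix_length_le)

lemma restr_Suc: "restr x (Suc n) = restr x n @ [x n]"
  by (simp add: restr_def)

lemma take_restr: "m \<le> n \<Longrightarrow> take m (restr x n) = restr x m"
  by (simp add: restr_def take_map)

lemma prefix_restr: "m \<le> n \<Longrightarrow> prefix (restr x m) (restr x n)"
  by (metis take_is_prefix take_restr)

lemma restr_eq_take: "ini s x \<Longrightarrow> m \<le> length s \<Longrightarrow> restr x m = take m s"
  unfolding ini_def by (metis take_restr)

text \<open>Digit \<open>i\<close> is read from \<open>h (Suc i)\<close>, which has more than
  \<open>i\<close> entries whenever \<open>n \<le> length (h n)\<close> for all
  \<open>n\<close>.\<close>

definition limit :: "(nat \<Rightarrow> nat list) \<Rightarrow> baire" where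
  "limit h = (\<lambda>i. h (Suc i) ! i)"

lemma ini_limit:
  assumes "\<And>n. prefix (h n) (h (Suc n))" "\<And>n. n \<le> length (h n)"
  shows "ini (h n) (limit h)"
proof -
  have mono: "prefix (h n) (h m)" if "n \<le> m" for n m
    using that by (induction rule: dec_induct) (auto intro: prefix_order.trans assms(1))
  have "h n ! i = h (Suc i) ! i" if "i < length (h n)" for i
  proof -
    have "prefix (h n) (h (max n (Suc i)))" "prefix (h (Suc i)) (h (max n (Suc i)))"
      by (intro mono; simp)+
    moreover have "i < length (h (Suc i))" using assms(2)[of "Suc i"] by simp
    ultimately show ?thesis using that by (metis nth_append prefixE)
  qed
  then show ?thesis by (simp add: ini_iff_nth limit_def)
qed

text \<open>Positions are coded as numbers, tagged 0, 1 or 2, so that the game falls under the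
  calculus of number relations.\<close>

definition P0 :: "nat list \<Rightarrow> nat list \<Rightarrow> nat" where
  "P0 s t = prod_encode (0, prod_encode (list_encode s, list_encode t))"

definition P1 :: "nat list \<Rightarrow> nat list \<Rightarrow> nat list \<Rightarrow> nat" where
  "P1 s t r = prod_encode (1, prod_encode (list_encode r, P0 s t))"

definition P2 :: "nat list \<Rightarrow> nat list \<Rightarrow> nat list \<Rightarrow> nat list \<Rightarrow> nat" where
  "P2 s t p q = prod_encode (2, prod_encode (list_encode p, prod_encode (list_encode q, P0 s t)))"

lemma position_inject [simp]:
  "P0 s t = P0 s' t' \<longleftrightarrow> s = s' \<and> t = t'"
  "P1 s t r = P1 s' t' r' \<longleftrightarrow> s = s' \<and> t = t' \<and> r = r'"
  "P2 s t p q = P2 s' t' p' q' \<longleftrightarrow> s = s' \<and> t = t' \<and> p = p' \<and> q = q'"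
  "P0 s t \<noteq> P1 s' t' r'" "P1 s' t' r' \<noteq> P0 s t" "P0 s t \<noteq> P2 s' t' p' q'" "P2 s' t' p' q' \<noteq> P0 s t"
  "P1 s t r \<noteq> P2 s' t' p' q'" "P2 s' t' p' q' \<noteq> P1 s t r"
  by (auto simp: P0_def P1_def P2_def list_encode_eq)

locale hurewicz =
  fixes S T :: "nat list \<Rightarrow> nat list \<Rightarrow> bool" and A :: "baire set"
  assumes S_length: "S s t \<Longrightarrow> length s = length t"
    and S_take: "S s t \<Longrightarrow> S (take n s) (take n t)"
    and T_take: "T s t \<Longrightarrow> T (take n s) (take n t)"
    and mem_A: "x \<in> A \<longleftrightarrow> (\<exists>y. \<forall>n. S (restr x n) (restr y n))"
    and not_mem_A: "x \<notin> A \<longleftrightarrow> (\<exists>y. \<forall>n. T (restr x n) (restr y n))"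
begin

definition ext :: "nat list \<Rightarrow> nat list \<Rightarrow> nat list \<Rightarrow> nat list \<Rightarrow> bool" where
  "ext s t s' t' \<longleftrightarrow> S s' t' \<and> prefix s s' \<and> prefix t t' \<and> length s < length s'"

text \<open>At \<open>P0 s t\<close> the second player announces a point of the compactification of Baire space outside
  \<open>A\<close> which is a limit of points with witnesses extending \<open>(s, t)\<close>: either the formal limit of the
  sequences \<open>r @ [n]\<close> with \<open>n\<close> tending to infinity (position \<open>P1\<close>), or a point of the complement of \<open>A\<close>,
  revealed digit by digit together with a witness (positions \<open>P2\<close>). The first player may at any time
  demand an extension of \<open>(s, t)\<close> close to that point.\<close>

definition move :: "nat \<Rightarrow> nat \<Rightarrow> nat \<Rightarrow> bool" where
  "move c i c' \<longleftrightarrow>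
    (\<exists>s t. c = P0 s t \<and> ((\<exists>r. c' = P1 s t r) \<or> c' = P2 s t [] [])) \<or>
    (\<exists>s t r. c = P1 s t r \<and> (\<exists>s' t' n. c' = P0 s' t' \<and> ext s t s' t' \<and> i \<le> n \<and> prefix (r @ [n]) s')) \<or>
    (\<exists>s t p q. c = P2 s t p q \<and>
       ((i = 0 \<and> (\<exists>a b. c' = P2 s t (p @ [a]) (q @ [b]) \<and> T (p @ [a]) (q @ [b]))) \<or>
        (i \<noteq> 0 \<and> (\<exists>s' t'. c' = P0 s' t' \<and> ext s t s' t' \<and> prefix p s'))))"

lemma move_P0: "move (P0 s t) i c' \<longleftrightarrow> (\<exists>r. c' = P1 s t r) \<or> c' = P2 s t [] []"
  unfolding move_def by simp

lemma move_P1: "move (P1 s t r) i c' \<longleftrightarrow>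
    (\<exists>s' t' n. c' = P0 s' t' \<and> ext s t s' t' \<and> i \<le> n \<and> prefix (r @ [n]) s')"
  unfolding move_def by simp

lemma move_P2: "move (P2 s t p q) i c' \<longleftrightarrow>
    (i = 0 \<and> (\<exists>a b. c' = P2 s t (p @ [a]) (q @ [b]) \<and> T (p @ [a]) (q @ [b]))) \<or>
    (i \<noteq> 0 \<and> (\<exists>s' t'. c' = P0 s' t' \<and> ext s t s' t' \<and> prefix p s'))"
  unfolding move_def by simp

sublocale open_game move .

lemma ext_trans: "ext s t s' t' \<Longrightarrow> S s'' t'' \<Longrightarrow> prefix s' s'' \<Longrightarrow> prefix t' t'' \<Longrightarrow> ext s t s'' t''"
  unfolding ext_def by (meson order_less_le_trans prefix_length_le prefix_order.trans)

definition lost :: "nat list \<Rightarrow> nat list \<Rightarrow> bool" where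
  "lost s t \<longleftrightarrow> \<not> won (P0 s t)"

lemma lost_step:
  assumes "lost s t"
  shows "(\<exists>r. \<forall>k. \<exists>s' t' n. ext s t s' t' \<and> lost s' t' \<and> k \<le> n \<and> prefix (r @ [n]) s') \<or>
    (\<exists>x. x \<notin> A \<and> (\<forall>k. \<exists>s' t'. ext s t s' t' \<and> lost s' t' \<and> prefix (restr x k) s'))"
proof -
  obtain c where c: "move (P0 s t) 0 c" "\<not> won c"
    using not_won_response[of "P0 s t" 0] assms unfolding lost_def by blast
  then consider r where "c = P1 s t r" | "c = P2 s t [] []" unfolding move_P0 by blast
  then show ?thesis
  proof cases
    case 1
    have "\<exists>s' t' n. ext s t s' t' \<and> lost s' t' \<and> k \<le> n \<and> prefix (r @ [n]) s'" for k
      using not_won_response[of c k] c(2) unfolding 1 move_P1 lost_def by blast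
    then show ?thesis by blast
  next
    case 2
    let ?B = "\<lambda>u. \<not> won (P2 s t (fst u) (snd u))"
    \<comment> \<open>The first player plays 0 forever, which makes the second player reveal a whole
      point together with a witness that it is outside \<open>A\<close>. Every position on the way
      remains not won, so a demand may be made at each of them.\<close>
    have "\<exists>h. \<forall>n. (?B (h n) \<and> length (fst (h n)) = n \<and> length (snd (h n)) = n) \<and>
        (T (fst (h (Suc n))) (snd (h (Suc n))) \<and> prefix (fst (h n)) (fst (h (Suc n))) \<and> prefix (snd (h n)) (snd (h (Suc n))))"
    proof (rule dependent_nat_choice)
      show "\<exists>u. ?B u \<and> length (fst u) = 0 \<and> length (snd u) = 0"
        using c(2) unfolding 2 by (intro exI[of _ "([], [])"]) simp
      fix u n assume u: "?B u \<and> length (fst u) = n \<and> length (snd u) = n"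
      obtain a b where "T (fst u @ [a]) (snd u @ [b])" "\<not> won (P2 s t (fst u @ [a]) (snd u @ [b]))"
        using not_won_response[of "P2 s t (fst u) (snd u)" 0] u unfolding move_P2 by blast
      with u show "\<exists>v. (?B v \<and> length (fst v) = Suc n \<and> length (snd v) = Suc n) \<and>
          T (fst v) (snd v) \<and> prefix (fst u) (fst v) \<and> prefix (snd u) (snd v)"
        by (intro exI[of _ "(fst u @ [a], snd u @ [b])"]) simp
    qed
    then obtain h where h: "\<And>n. ?B (h n)" "\<And>n. length (fst (h n)) = n" "\<And>n. length (snd (h n)) = n"
      "\<And>n. T (fst (h (Suc n))) (snd (h (Suc n)))" "\<And>n. prefix (fst (h n)) (fst (h (Suc n)))"
      "\<And>n. prefix (snd (h n)) (snd (h (Suc n)))" by blast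
    define x where "x = limit (\<lambda>n. fst (h n))"
    define y where "y = limit (\<lambda>n. snd (h n))"
    have x: "restr x n = fst (h n)" for n
      using ini_limit[of "\<lambda>n. fst (h n)" n] h unfolding x_def ini_def by simp
    have y: "restr y n = snd (h n)" for n
      using ini_limit[of "\<lambda>n. snd (h n)" n] h unfolding y_def ini_def by simp
    have TS: "T (restr x (Suc n)) (restr y (Suc n))" for n
      using h(4) by (simp add: x y)
    have "T (restr x n) (restr y n)" for n
      using T_take[OF TS[of n], of n] by (simp add: take_restr)
    then have "x \<notin> A" using not_mem_A by blast
    moreover have "\<exists>s' t'. ext s t s' t' \<and> lost s' t' \<and> prefix (restr x k) s'" for k
      using not_won_response[of "P2 s t (fst (h k)) (snd (h k))" 1] h(1)[of k]
      unfolding move_P2 lost_def x by auto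
    ultimately show ?thesis by blast
  qed
qed

lemma lost_ext: "lost s t \<Longrightarrow> \<exists>s' t'. ext s t s' t' \<and> lost s' t'"
  using lost_step by meson

text \<open>Repeated extension builds the point and its witness in \<open>S\<close> together. The
  limit is thus in \<open>A\<close>, and cannot equal an announced point outside
  \<open>A\<close>.\<close>

lemma lost_branch:
  assumes "lost s t" "S s t"
  obtains x where "x \<in> A" "ini s x"
    "\<And>m. \<exists>s' t'. S s' t' \<and> lost s' t' \<and> prefix s s' \<and> prefix t t' \<and> ini s' x \<and> m \<le> length s'"
proof -
  let ?P = "\<lambda>n u. S (fst u) (snd u) \<and> lost (fst u) (snd u) \<and> prefix s (fst u) \<and> prefix t (snd u) \<and> n \<le> length (fst u)"
  have "\<exists>h. \<forall>n. ?P n (h n) \<and> (prefix (fst (h n)) (fst (h (Suc n))) \<and> prefix (snd (h n)) (snd (h (Suc n))))"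
  proof (rule dependent_nat_choice)
    show "\<exists>u. ?P 0 u" using assms by (intro exI[of _ "(s, t)"]) simp
    fix u n assume u: "?P n u"
    then obtain s' t' where e: "ext (fst u) (snd u) s' t'" "lost s' t'" using lost_ext by blast
    with u have "prefix s s'" "prefix t t'" unfolding ext_def by (meson prefix_order.trans)+
    with u e show "\<exists>v. ?P (Suc n) v \<and> prefix (fst u) (fst v) \<and> prefix (snd u) (snd v)"
      by (intro exI[of _ "(s', t')"]) (auto simp: ext_def)
  qed
  then obtain h where P: "\<And>n. ?P n (h n)"
    and mono: "\<And>n. prefix (fst (h n)) (fst (h (Suc n)))" "\<And>n. prefix (snd (h n)) (snd (h (Suc n)))" by blast
  define x where "x = limit (\<lambda>n. fst (h n))"
  define y where "y = limit (\<lambda>n. snd (h n))"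
  have len: "n \<le> length (fst (h n))" "n \<le> length (snd (h n))" for n
    using P[of n] S_length[of "fst (h n)" "snd (h n)"] by simp_all
  have x: "ini (fst (h n)) x" and y: "ini (snd (h n)) y" for n
    unfolding x_def y_def using mono len by (auto intro!: ini_limit)
  have "S (restr x n) (restr y n)" for n
    using S_take[of "fst (h n)" "snd (h n)" n] P[of n] x[of n] y[of n] len[of n] by (simp add: restr_eq_take)
  then have "x \<in> A" using mem_A by blast
  moreover have "ini s x" using ini_prefix[OF _ x[of 0]] P[of 0] by blast
  ultimately show thesis using that P x by blast
qed

text \<open>The second property says that the children of \<open>(s, t)\<close> accumulate at no point of \<open>A\<close>.\<close>

definition scattered :: "(nat \<Rightarrow> nat list) \<Rightarrow> bool" where
  "scattered c \<longleftrightarrow> (\<forall>z n n'. ini (c n) z \<and> ini (c n') z \<longrightarrow> n = n') \<and>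
     (\<forall>z\<in>A. \<exists>m. \<forall>n w. ini (c n) w \<and> restr w m = restr z m \<longrightarrow> ini (c n) z)"

text \<open>Condition \<open>lf\<close> keeps all but finitely many nodes away from a neighbourhood
  of \<open>z\<close>. The remaining nodes are settled by their lengths.\<close>

lemma scatteredI:
  assumes inf: "infinite D"
    and disj: "\<And>z d d'. d \<in> D \<Longrightarrow> d' \<in> D \<Longrightarrow> ini (f d) z \<Longrightarrow> ini (f d') z \<Longrightarrow> d = (d' :: nat)"
    and lf: "\<And>z. z \<in> A \<Longrightarrow> \<exists>m N. \<forall>d\<in>D. N \<le> d \<longrightarrow> (\<forall>w. ini (f d) w \<longrightarrow> restr w m \<noteq> restr z m)"
  shows "scattered (\<lambda>n. f (enumerate D n))"
  unfolding scattered_def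
proof (intro conjI allI impI ballI)
  fix z n n' assume "ini (f (enumerate D n)) z \<and> ini (f (enumerate D n')) z"
  then have "enumerate D n = enumerate D n'" using disj enumerate_in_set[OF inf] by blast
  then show "n = n'" using strict_mono_enumerate[OF inf] strict_mono_eq by blast
next
  fix z assume "z \<in> A"
  then obtain m N where mN: "\<And>d w. d \<in> D \<Longrightarrow> N \<le> d \<Longrightarrow> ini (f d) w \<Longrightarrow> restr w m \<noteq> restr z m"
    using lf by meson
  \<comment> \<open>\<open>enumerate D n\<close> is at least \<open>n\<close>, so only indices below
    \<open>N\<close> remain. Agreement up to the length of such a node decides whether
    \<open>z\<close> extends it.\<close>
  define M where "M = Max (insert m ((\<lambda>n. length (f (enumerate D n))) ` {..<N}))"
  show "\<exists>m. \<forall>n w. ini (f (enumerate D n)) w \<and> restr w m = restr z m \<longrightarrow> ini (f (enumerate D n)) z"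
  proof (intro exI[of _ M] allI impI)
    fix n w assume w: "ini (f (enumerate D n)) w \<and> restr w M = restr z M"
    have "m \<le> M" unfolding M_def by simp
    with w have "restr w m = restr z m" using restr_eq_mono by blast
    with mN w enumerate_in_set[OF inf] have "\<not> N \<le> enumerate D n" by blast
    with le_enumerate[OF inf, of n] have "n < N" by simp
    then have "length (f (enumerate D n)) \<le> M" unfolding M_def by (intro Max_ge) auto
    with w have "restr w (length (f (enumerate D n))) = restr z (length (f (enumerate D n)))"
      using restr_eq_mono by blast
    with w show "ini (f (enumerate D n)) z" unfolding ini_def by simp
  qed
qed

text \<open>Infinitely many answers converging to a limit outside \<open>A\<close> are thinned out
  to pairwise incompatible ones. For a formal limit \<open>r\<close> they differ in the digit after
  \<open>r\<close>; for a point \<open>x\<close> they leave \<open>x\<close> at different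
  digits.\<close>

lemma lost_children:
  assumes "lost s t"
  shows "\<exists>c. (\<forall>n. ext s t (fst (c n)) (snd (c n)) \<and> lost (fst (c n)) (snd (c n))) \<and> scattered (\<lambda>n. fst (c n))"
proof -
  have main: ?thesis if inf: "infinite D"
    and f: "\<forall>d\<in>D. ext s t (fst (f d)) (snd (f d)) \<and> lost (fst (f d)) (snd (f d))"
    and disj: "\<And>z d d'. d \<in> D \<Longrightarrow> d' \<in> D \<Longrightarrow> ini (fst (f d)) z \<Longrightarrow> ini (fst (f d')) z \<Longrightarrow> d = d'"
    and lf: "\<And>z. z \<in> A \<Longrightarrow> \<exists>m N. \<forall>d\<in>D. N \<le> d \<longrightarrow> (\<forall>w. ini (fst (f d)) w \<longrightarrow> restr w m \<noteq> restr z m)"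
  for D :: "nat set" and f
  proof (intro exI[of _ "\<lambda>n. f (enumerate D n)"] conjI allI)
    show "scattered (\<lambda>n. fst (f (enumerate D n)))"
      by (rule scatteredI[where f = "\<lambda>d. fst (f d)", OF inf disj lf])
  qed (use f enumerate_in_set[OF inf] in auto)
  from lost_step[OF assms] show ?thesis
  proof (elim disjE exE conjE)
    fix r assume r: "\<forall>k. \<exists>s' t' n. ext s t s' t' \<and> lost s' t' \<and> k \<le> n \<and> prefix (r @ [n]) s'"
    define D where "D = {n. \<exists>u. ext s t (fst u) (snd u) \<and> lost (fst u) (snd u) \<and> prefix (r @ [n]) (fst u)}"
    have inf: "infinite D"
      unfolding infinite_nat_iff_unbounded_le
    proof
      fix k
      obtain s' t' n where "ext s t s' t'" "lost s' t'" "k \<le> n" "prefix (r @ [n]) s'" using r by blast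
      then show "\<exists>n\<ge>k. n \<in> D" unfolding D_def by (intro exI[of _ n]) auto
    qed
    have "\<forall>d\<in>D. \<exists>u. ext s t (fst u) (snd u) \<and> lost (fst u) (snd u) \<and> prefix (r @ [d]) (fst u)"
      unfolding D_def by blast
    from bchoice[OF this] obtain f where
      f: "\<forall>d\<in>D. ext s t (fst (f d)) (snd (f d)) \<and> lost (fst (f d)) (snd (f d)) \<and> prefix (r @ [d]) (fst (f d))" ..
    have at_r: "w (length r) = d" if "d \<in> D" "ini (fst (f d)) w" for d w
    proof -
      have "ini (r @ [d]) w" using f that ini_prefix by blast
      then show ?thesis by (auto simp: ini_iff_nth dest: spec[of _ "length r"])
    qed
    show ?thesis
    proof (rule main[OF inf, of f])
      fix z assume "z \<in> A"
      have "restr w (Suc (length r)) \<noteq> restr z (Suc (length r))" 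
        if "d \<in> D" "Suc (z (length r)) \<le> d" "ini (fst (f d)) w" for d w
        using at_r[OF that(1,3)] that(2) by (auto simp: restr_Suc)
      then show "\<exists>m N. \<forall>d\<in>D. N \<le> d \<longrightarrow> (\<forall>w. ini (fst (f d)) w \<longrightarrow> restr w m \<noteq> restr z m)" by blast
    qed (use f at_r in blast)+
  next
    fix x assume xA: "x \<notin> A" and x: "\<forall>k. \<exists>s' t'. ext s t s' t' \<and> lost s' t' \<and> prefix (restr x k) s'"
    define leaves where "leaves d s' \<longleftrightarrow> d < length s' \<and> s' ! d \<noteq> x d \<and> (\<forall>i<d. s' ! i = x i)" for d s'
    define D where "D = {d. \<exists>u. ext s t (fst u) (snd u) \<and> lost (fst u) (snd u) \<and> leaves d (fst u)}"
    have inf: "infinite D"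
      unfolding infinite_nat_iff_unbounded_le
    proof
      \<comment> \<open>A node that agrees with \<open>x\<close> on \<open>k\<close> digits may be
        an initial segment of \<open>x\<close>. It is extended towards a point \<open>z\<close> of
        \<open>A\<close>; since \<open>z \<noteq> x\<close>, a sufficiently long node below
        \<open>z\<close> leaves \<open>x\<close> at some \<open>d \<ge> k\<close>.\<close>
      fix k
      obtain s' t' where s': "ext s t s' t'" "lost s' t'" "prefix (restr x k) s'" using x by blast
      then have "S s' t'" by (simp add: ext_def)
      then obtain z where z: "z \<in> A" "ini s' z"
        "\<And>m. \<exists>s'' t''. S s'' t'' \<and> lost s'' t'' \<and> prefix s' s'' \<and> prefix t' t'' \<and> ini s'' z \<and> m \<le> length s''"
        using lost_branch[OF s'(2)] by metis
      from z(1) xA have "z \<noteq> x" by blast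
      then have "\<exists>d. z d \<noteq> x d" by (simp add: fun_eq_iff)
      then obtain d where d: "z d \<noteq> x d" "\<And>i. i < d \<Longrightarrow> z i = x i"
        using exists_least_iff[of "\<lambda>d. z d \<noteq> x d"] by auto
      have "ini (restr x k) z" using s'(3) z(2) ini_prefix by blast
      then have "k \<le> d" using d(1) by (auto simp: ini_iff_nth restr_def not_le[symmetric])
      obtain s'' t'' where s'': "S s'' t''" "lost s'' t''" "prefix s' s''" "prefix t' t''" "ini s'' z" "Suc d \<le> length s''"
        using z(3) by blast
      then have "leaves d s''" unfolding leaves_def using d by (auto simp: ini_iff_nth)
      with s''(2) ext_trans[OF s'(1) s''(1,3,4)] have "d \<in> D"
        unfolding D_def by (intro CollectI exI[of _ "(s'', t'')"]) simp
      with \<open>k \<le> d\<close> show "\<exists>n\<ge>k. n \<in> D" by blast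
    qed
    have "\<forall>d\<in>D. \<exists>u. ext s t (fst u) (snd u) \<and> lost (fst u) (snd u) \<and> leaves d (fst u)"
      unfolding D_def by blast
    from bchoice[OF this] obtain f where
      f: "\<forall>d\<in>D. ext s t (fst (f d)) (snd (f d)) \<and> lost (fst (f d)) (snd (f d)) \<and> leaves d (fst (f d))" ..
    have at_d: "w d \<noteq> x d" "\<And>i. i < d \<Longrightarrow> w i = x i" if "d \<in> D" "ini (fst (f d)) w" for d w
      using f that unfolding leaves_def ini_iff_nth by force+
    show ?thesis
    proof (rule main[OF inf, of f])
      fix z d d' assume "d \<in> D" "d' \<in> D" "ini (fst (f d)) z" "ini (fst (f d')) z"
      then show "d = d'" using at_d by (metis linorder_neqE_nat)
    next
      fix z assume "z \<in> A"
      with xA have "z \<noteq> x" by blast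
      then obtain i where i: "z i \<noteq> x i" by (auto simp: fun_eq_iff)
      have "restr w (Suc i) \<noteq> restr z (Suc i)" if "d \<in> D" "Suc i \<le> d" "ini (fst (f d)) w" for d w
        using at_d(2)[OF that(1,3), of i] that(2) i by (auto simp: restr_Suc)
      then show "\<exists>m N. \<forall>d\<in>D. N \<le> d \<longrightarrow> (\<forall>w. ini (fst (f d)) w \<longrightarrow> restr w m \<noteq> restr z m)" by blast
    qed (use f in blast)
  qed
qed

text \<open>A sequence \<open>\<alpha>\<close> selects one child at each level. Its limit is in
  \<open>A\<close> because the witnesses converge as well, and the embedding is closed because
  children accumulate nowhere in \<open>A\<close>.\<close>

lemma closed_copy_of_baire:
  assumes "lost [] []"
  shows "\<exists>Y. Y \<subseteq> A \<and> Y homeomorphic (UNIV :: baire set) \<and> closedin (top_of_set A) Y"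
proof -
  obtain ch where ch: "\<And>s t n. lost s t \<Longrightarrow> ext s t (fst (ch s t n)) (snd (ch s t n))"
    "\<And>s t n. lost s t \<Longrightarrow> lost (fst (ch s t n)) (snd (ch s t n))"
    "\<And>s t. lost s t \<Longrightarrow> scattered (\<lambda>n. fst (ch s t n))"
    using lost_children by metis
  define nd where "nd \<alpha> k = rec_nat ([], []) (\<lambda>k u. ch (fst u) (snd u) (\<alpha> k)) k" for \<alpha> :: baire and k
  have nd_0: "nd \<alpha> 0 = ([], [])" and nd_Suc: "nd \<alpha> (Suc k) = ch (fst (nd \<alpha> k)) (snd (nd \<alpha> k)) (\<alpha> k)" for \<alpha> k
    by (simp_all add: nd_def)
  have lost: "lost (fst (nd \<alpha> k)) (snd (nd \<alpha> k))" for \<alpha> k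
    by (induction k) (use assms in \<open>simp_all add: nd_0 nd_Suc ch\<close>)
  have ext: "ext (fst (nd \<alpha> k)) (snd (nd \<alpha> k)) (fst (nd \<alpha> (Suc k))) (snd (nd \<alpha> (Suc k)))" for \<alpha> k
    unfolding nd_Suc by (rule ch(1)[OF lost])
  have len: "k \<le> length (fst (nd \<alpha> k))" for \<alpha> k
  proof (induction k)
    case (Suc k)
    with ext[of \<alpha> k] show ?case unfolding ext_def by simp
  qed simp
  have len2: "k \<le> length (snd (nd \<alpha> k))" for \<alpha> k
  proof (cases k)
    case (Suc j)
    with ext[of \<alpha> j] have "S (fst (nd \<alpha> k)) (snd (nd \<alpha> k))" by (simp add: ext_def)
    then show ?thesis using S_length len[of k \<alpha>] by simp
  qed simp
  have nd_cong: "restr \<alpha> k = restr \<beta> k \<Longrightarrow> nd \<alpha> k = nd \<beta> k" for \<alpha> \<beta> k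
    by (induction k) (simp_all add: nd_0 nd_Suc restr_Suc)
  define F where "F \<alpha> = limit (\<lambda>k. fst (nd \<alpha> k))" for \<alpha>
  define G where "G \<alpha> = limit (\<lambda>k. snd (nd \<alpha> k))" for \<alpha>
  have iniF: "ini (fst (nd \<alpha> k)) (F \<alpha>)" and iniG: "ini (snd (nd \<alpha> k)) (G \<alpha>)" for \<alpha> k
    unfolding F_def G_def using ext len len2 by (auto intro!: ini_limit simp: ext_def)
  have FA: "F \<alpha> \<in> A" for \<alpha>
  proof -
    have "S (restr (F \<alpha>) n) (restr (G \<alpha>) n)" for n
    proof -
      have "S (fst (nd \<alpha> (Suc n))) (snd (nd \<alpha> (Suc n)))" using ext[of \<alpha> n] by (simp add: ext_def)
      from S_take[OF this, of n] show ?thesis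
        using iniF[of \<alpha> "Suc n"] iniG[of \<alpha> "Suc n"] len[of "Suc n" \<alpha>] len2[of "Suc n" \<alpha>]
        by (simp add: restr_eq_take)
    qed
    then show ?thesis using mem_A by blast
  qed
  have scat: "scattered (\<lambda>n. fst (ch (fst (nd \<alpha> k)) (snd (nd \<alpha> k)) n))" for \<alpha> k
    using ch(3)[OF lost] .
  \<comment> \<open>Selections whose limits come close to \<open>z\<close> agree on \<open>k\<close>
    digits: local finiteness puts their nodes on \<open>z\<close>, and disjointness makes these
    nodes equal. With \<open>z\<close> in the range this yields injectivity and continuity of the
    inverse; with any \<open>z\<close> in \<open>A\<close> it yields closedness.\<close>
  have near: "\<exists>m. \<forall>\<beta> \<beta>'. restr (F \<beta>) m = restr z m \<longrightarrow> restr (F \<beta>') m = restr z m \<longrightarrow>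
      restr \<beta> k = restr \<beta>' k \<and> ini (fst (nd \<beta> k)) z" if zA: "z \<in> A" for z k
  proof (induction k)
    case 0
    show ?case by (simp add: nd_0 ini_def)
  next
    case (Suc k)
    then obtain m where m: "\<And>\<beta> \<beta>'. restr (F \<beta>) m = restr z m \<Longrightarrow> restr (F \<beta>') m = restr z m \<Longrightarrow>
      restr \<beta> k = restr \<beta>' k \<and> ini (fst (nd \<beta> k)) z" by metis
    show ?case
    proof (cases "\<exists>\<alpha>. restr (F \<alpha>) m = restr z m")
      case True
      then obtain \<alpha> where \<alpha>: "restr (F \<alpha>) m = restr z m" ..
      let ?c = "\<lambda>n. fst (ch (fst (nd \<alpha> k)) (snd (nd \<alpha> k)) n)"
      obtain m' where m': "\<And>n w. ini (?c n) w \<Longrightarrow> restr w m' = restr z m' \<Longrightarrow> ini (?c n) z"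
        using scat[of \<alpha> k] zA unfolding scattered_def by meson
      have *: "restr \<beta> k = restr \<alpha> k \<and> ini (?c (\<beta> k)) z \<and> fst (nd \<beta> (Suc k)) = ?c (\<beta> k)"
        if "restr (F \<beta>) (max m m') = restr z (max m m')" for \<beta>
      proof -
        have a: "restr (F \<beta>) m = restr z m" "restr (F \<beta>) m' = restr z m'"
          using that by (auto elim: restr_eq_mono)
        have b: "restr \<beta> k = restr \<alpha> k" using m[OF a(1) \<alpha>] by simp
        then have c: "fst (nd \<beta> (Suc k)) = ?c (\<beta> k)" unfolding nd_Suc using nd_cong by metis
        show ?thesis using b c m'[OF _ a(2)] iniF[of \<beta> "Suc k"] by simp
      qed
      show ?thesis
      proof (intro exI[of _ "max m m'"] allI impI)
        fix \<beta> \<beta>' assume "restr (F \<beta>) (max m m') = restr z (max m m')" "restr (F \<beta>') (max m m') = restr z (max m m')"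
        note 1 = *[OF this(1)] and 2 = *[OF this(2)]
        have "\<beta> k = \<beta>' k" using scat[of \<alpha> k] 1 2 unfolding scattered_def by blast
        with 1 2 show "restr \<beta> (Suc k) = restr \<beta>' (Suc k) \<and> ini (fst (nd \<beta> (Suc k))) z"
          by (simp add: restr_Suc)
      qed
    qed blast
  qed
  have eqI: "\<alpha> = \<beta>" if "\<And>k. restr \<alpha> k = restr \<beta> k" for \<alpha> \<beta>
  proof
    fix i show "\<alpha> i = \<beta> i" using that[of "Suc i"] by (simp add: restr_Suc)
  qed
  have contF: "continuous_on UNIV F"
  proof (rule continuous_on_baire, intro exI ballI impI)
    fix \<alpha> \<beta> n assume "restr \<beta> n = restr \<alpha> n"
    then have "nd \<beta> n = nd \<alpha> n" by (rule nd_cong)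
    then show "restr (F \<beta>) n = restr (F \<alpha>) n"
      using iniF[of \<alpha> n] iniF[of \<beta> n] len[of n \<alpha>] by (simp add: restr_eq_take)
  qed
  have inv: "\<exists>m. \<forall>\<beta>. restr (F \<beta>) m = restr (F \<alpha>) m \<longrightarrow> restr \<beta> k = restr \<alpha> k" for \<alpha> k
    using near[OF FA, of \<alpha> k] by metis
  have "inj F"
  proof (rule injI, rule eqI)
    fix \<alpha> \<beta> k assume "F \<alpha> = F \<beta>"
    then show "restr \<alpha> k = restr \<beta> k" using inv[of \<beta> k] by metis
  qed
  then have inv_F: "inv F (F \<beta>) = \<beta>" for \<beta>
    by (rule inv_f_f)
  have contG: "continuous_on (range F) (inv F)"
  proof (rule continuous_on_baire)
    fix z n assume "z \<in> range F"
    then obtain \<alpha> where z: "z = F \<alpha>" by blast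
    obtain m where m: "\<And>\<beta>. restr (F \<beta>) m = restr (F \<alpha>) m \<Longrightarrow> restr \<beta> n = restr \<alpha> n"
      using inv by metis
    show "\<exists>m. \<forall>y\<in>range F. restr y m = restr z m \<longrightarrow> restr (inv F y) n = restr (inv F z) n"
    proof (intro exI ballI impI)
      fix y assume "y \<in> range F" and eq: "restr y m = restr z m"
      then obtain \<beta> where y: "y = F \<beta>" by blast
      show "restr (inv F y) n = restr (inv F z) n"
        unfolding y z inv_F by (rule m[OF eq[unfolded y z]])
    qed
  qed
  have "homeomorphism UNIV (range F) F (inv F)"
    unfolding homeomorphism_def using contF contG by (simp add: image_image inv_F)
  then have "(UNIV :: baire set) homeomorphic range F"
    unfolding homeomorphic_def by blast
  then have "range F homeomorphic (UNIV :: baire set)"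
    by (rule homeomorphic_sym[THEN iffD1])
  moreover have "closedin (top_of_set A) (range F)"
  proof (rule closedin_baire)
    show "range F \<subseteq> A" using FA by blast
    fix z assume zA: "z \<in> A" and "\<forall>m. \<exists>y\<in>range F. restr y m = restr z m"
    then have "\<forall>m. \<exists>\<beta>. restr (F \<beta>) m = restr z m" by blast
    then obtain b where b: "\<And>m. restr (F (b m)) m = restr z m" by metis
    obtain m where m: "\<And>k \<beta> \<beta>'. restr (F \<beta>) (m k) = restr z (m k) \<Longrightarrow> restr (F \<beta>') (m k) = restr z (m k) \<Longrightarrow>
      restr \<beta> k = restr \<beta>' k \<and> ini (fst (nd \<beta> k)) z"
      using near[OF zA] by metis
    \<comment> \<open>The sum bounds each of \<open>m 0\<close> to \<open>m k\<close>, so the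
      approximation \<open>b (M k)\<close> is close enough to \<open>z\<close> at all levels up to
      \<open>k\<close>.\<close>
    define M where "M k = (\<Sum>j\<le>k. m j)" for k
    have bM: "restr (F (b (M k))) (m j) = restr z (m j)" if "j \<le> k" for j k
    proof (rule restr_eq_mono[OF b])
      show "m j \<le> M k" unfolding M_def using that by (intro member_le_sum) auto
    qed
    \<comment> \<open>Digit \<open>i\<close> of \<open>b (M k)\<close> is the same for all
      \<open>k > i\<close>; the preimage of \<open>z\<close> collects these stable digits.\<close>
    define \<alpha> where "\<alpha> i = b (M (Suc i)) i" for i
    have "\<alpha> i = b (M k) i" if "i < k" for i k
    proof -
      have "restr (b (M (Suc i))) (Suc i) = restr (b (M k)) (Suc i)"
        using m[OF bM bM, of "Suc i" "Suc i" k] that by simp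
      then show ?thesis by (simp add: \<alpha>_def restr_Suc)
    qed
    then have \<alpha>: "restr \<alpha> k = restr (b (M k)) k" for k by (simp add: restr_def)
    have iniz: "ini (fst (nd \<alpha> k)) z" for k
      using m[OF bM bM, of k k k] nd_cong[OF \<alpha>[of k]] by simp
    have "restr (F \<alpha>) k = restr z k" for k
      using restr_eq_take[OF iniF[of \<alpha> k] len[of k \<alpha>]] restr_eq_take[OF iniz[of k] len[of k \<alpha>]] by simp
    then have "F \<alpha> = z" by (rule eqI)
    then show "z \<in> range F" by blast
  qed
  ultimately show ?thesis using FA by (intro exI[of _ "range F"]) auto
qed

section \<open>Finitely branching trees with bodies inside \<open>A\<close>\<close>

definition raw_tree :: "nat list \<Rightarrow> nat list \<Rightarrow> nat list set" where
  "raw_tree s t = {r. \<exists>s' t'. ext s t s' t' \<and> no_later (P0 s t) (P0 s' t') \<and> prefix r s'}"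

text \<open>Extensions of every length are required instead of a branch, so that only number
  quantifiers occur; for finitely branching trees the two agree by Koenig's lemma. The first
  condition empties the tree unless \<open>(s, t)\<close> is won no later than the root.\<close>

definition cover_tree :: "nat list \<Rightarrow> nat list \<Rightarrow> nat list set" where
  "cover_tree s t = {r. no_later (P0 s t) (P0 [] []) \<and> (\<forall>n. \<exists>w. length w = n \<and> r @ w \<in> raw_tree s t)}"

lemma raw_tree_prefix: "r \<in> raw_tree s t \<Longrightarrow> prefix r' r \<Longrightarrow> r' \<in> raw_tree s t"
  unfolding raw_tree_def using prefix_order.trans by blast

text \<open>The winning answer \<open>k\<close> to the announcement of \<open>r\<close> bounds the
  digits: a node through \<open>r @ [n]\<close> with \<open>k \<le> n\<close> would be a legal
  reply, hence won before \<open>(s, t)\<close>.\<close>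

lemma finite_raw_tree:
  assumes "won (P0 s t)" shows "finite {n. r @ [n] \<in> raw_tree s t}"
proof -
  let ?u = "P0 s t"
  have "P1 s t r \<in> before ?u"
    using assms by (auto simp: won_iff forced_def move_P0)
  then obtain k where k: "\<And>p'. move (P1 s t r) k p' \<Longrightarrow> p' \<in> before ?u" using before_move by blast
  have "n < k" if "r @ [n] \<in> raw_tree s t" for n
  proof (rule ccontr)
    assume n: "\<not> n < k"
    from that obtain s' t' where s': "ext s t s' t'" "no_later ?u (P0 s' t')" "prefix (r @ [n]) s'"
      unfolding raw_tree_def by blast
    with n have "move (P1 s t r) k (P0 s' t')" unfolding move_P1 by (auto simp: not_less)
    with k s'(2) no_later_iff_not_before[OF assms] show False by blast
  qed
  then have "{n. r @ [n] \<in> raw_tree s t} \<subseteq> {..<k}" by blast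
  then show ?thesis using finite_subset by blast
qed

text \<open>Otherwise the second player could announce \<open>x\<close> and reveal it forever with a
  witness. By \<open>stage_path\<close> the first player demands an extension somewhere, and the
  node witnessing that \<open>restr x n\<close> belongs to the tree is a reply that is won too
  late.\<close>

lemma body_raw_tree:
  assumes "won (P0 s t)" shows "body (raw_tree s t) \<subseteq> A"
proof
  let ?u = "P0 s t"
  fix x assume x: "x \<in> body (raw_tree s t)"
  show "x \<in> A"
  proof (rule ccontr)
    assume "x \<notin> A"
    then obtain y where y: "\<And>n. T (restr x n) (restr y n)" using not_mem_A by blast
    define c where "c n = P2 s t (restr x n) (restr y n)" for n
    have "c 0 \<in> before ?u"
      using assms by (auto simp: won_iff forced_def move_P0 c_def)
    moreover have "move (c n) 0 (c (Suc n))" for n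
      using y[of "Suc n"] unfolding c_def move_P2 by (simp add: restr_Suc)
    ultimately obtain n j where j: "j \<noteq> 0" "\<And>p'. move (c n) j p' \<Longrightarrow> p' \<in> before ?u"
      using stage_path[OF stage_before, of c 0 ?u 0] by blast
    have "restr x n \<in> raw_tree s t" using x by (simp add: body_def)
    then obtain s' t' where s': "ext s t s' t'" "no_later ?u (P0 s' t')" "prefix (restr x n) s'"
      unfolding raw_tree_def by blast
    with j(1) have "move (c n) j (P0 s' t')" unfolding c_def move_P2 by auto
    with j(2) s'(2) no_later_iff_not_before[OF assms] show False by blast
  qed
qed

lemma compact_cover_tree: "compact_tree (cover_tree s t)"
  unfolding compact_tree_def
proof (intro conjI ballI)
  show "is_tree (cover_tree s t)"
    unfolding is_tree_def
  proof (intro ballI allI impI)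
    fix r r' assume r: "r \<in> cover_tree s t" and "prefix r' r"
    then obtain v where v: "r = r' @ v" by (auto simp: prefix_def)
    have "\<exists>w. length w = n \<and> r' @ w \<in> raw_tree s t" for n
    proof -
      obtain w where w: "length w = n" "r @ w \<in> raw_tree s t" using r unfolding cover_tree_def by blast
      have "prefix (r' @ take n (v @ w)) (r @ w)" unfolding v append_assoc by (simp add: take_is_prefix del: take_append)
      with w show ?thesis by (intro exI[of _ "take n (v @ w)"]) (auto intro: raw_tree_prefix)
    qed
    with r show "r' \<in> cover_tree s t" unfolding cover_tree_def by blast
  qed
next
  have won: "won (P0 s t)" if "r \<in> cover_tree s t" for r
    using that no_later_won unfolding cover_tree_def by blast
  show "pruned (cover_tree s t)"
    unfolding pruned_def
  proof (rule ballI, rule ccontr)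
    fix r assume r: "r \<in> cover_tree s t" and "\<nexists>n. r @ [n] \<in> cover_tree s t"
    then have "\<forall>n. \<exists>k. \<forall>w. length w = k \<longrightarrow> (r @ [n]) @ w \<notin> raw_tree s t"
      unfolding cover_tree_def by blast
    then obtain k where k: "\<And>n w. length w = k n \<Longrightarrow> (r @ [n]) @ w \<notin> raw_tree s t" by metis
    let ?F = "{n. r @ [n] \<in> raw_tree s t}"
    have fin: "finite ?F" using finite_raw_tree[OF won[OF r]] .
    \<comment> \<open>Koenig's argument: \<open>K\<close> bounds the depths at which the finitely
      many children in the raw tree die out, but an extension of length \<open>Suc K\<close> passes
      through one of them.\<close>
    define K where "K = Max (insert 0 (k ` ?F))"
    obtain v where v: "length v = Suc K" "r @ v \<in> raw_tree s t" using r unfolding cover_tree_def by blast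
    then obtain n w where w: "v = n # w" "length w = K" by (metis length_Suc_conv)
    have n: "n \<in> ?F" using raw_tree_prefix[OF v(2), of "r @ [n]"] w by simp
    then have "k n \<le> K" unfolding K_def using fin by (intro Max_ge) auto
    have "prefix ((r @ [n]) @ take (k n) w) (r @ v)" unfolding w(1) by (simp add: take_is_prefix)
    from raw_tree_prefix[OF v(2) this] k[of "take (k n) w" n] \<open>k n \<le> K\<close> w(2) show False by simp
  qed
  fix r assume r: "r \<in> cover_tree s t"
  have "{n. r @ [n] \<in> cover_tree s t} \<subseteq> {n. r @ [n] \<in> raw_tree s t}"
    unfolding cover_tree_def by auto
  then show "finite {n. r @ [n] \<in> cover_tree s t}"
    using finite_raw_tree[OF won[OF r]] finite_subset by blast
qed

lemma body_cover_tree: "body (cover_tree s t) \<subseteq> A"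
proof
  fix x assume x: "x \<in> body (cover_tree s t)"
  then have "won (P0 s t)" using no_later_won unfolding body_def cover_tree_def by blast
  moreover have "x \<in> body (raw_tree s t)"
    using x unfolding body_def cover_tree_def by force
  ultimately show "x \<in> A" using body_raw_tree by blast
qed

text \<open>Take a node of the witnessed branch that is won at a minimal stage. Minimality against
  longer nodes puts the branch into the raw tree; minimality against \<open>u 0\<close>, the root,
  gives the first condition of \<open>cover_tree\<close>.\<close>

lemma cover_tree_covers:
  assumes "won (P0 [] [])" "x \<in> A"
  shows "\<exists>s t. x \<in> body (cover_tree s t)"
proof -
  obtain y where y: "\<And>n. S (restr x n) (restr y n)" using assms(2) mem_A by blast
  define u where "u n = P0 (restr x n) (restr y n)" for n
  have u0: "u 0 = P0 [] []" by (simp add: u_def)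
  obtain n where n: "won (u n)" "\<And>m. u m \<notin> before (u n)"
    using won_minimal[of u 0] assms(1) unfolding u0 by blast
  have late: "no_later (u n) (u m)" for m
    using no_later_iff_not_before[OF n(1)] n(2) by blast
  have "restr x m \<in> raw_tree (restr x n) (restr y n)" for m
  proof -
    \<comment> \<open>\<open>Suc n\<close> is needed because \<open>ext\<close> demands a proper
      extension.\<close>
    let ?M = "max m (Suc n)"
    have "ext (restr x n) (restr y n) (restr x ?M) (restr y ?M)"
      unfolding ext_def using y by (auto intro: prefix_restr)
    then show ?thesis
      unfolding raw_tree_def using late[of ?M] prefix_restr[of m ?M x] by (auto simp: u_def)
  qed
  moreover have "restr x m @ drop m (restr x (m + k)) = restr x (m + k)" for m k
    using append_take_drop_id[of m "restr x (m + k)"] take_restr[of m "m + k" x] by simp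
  then have "\<exists>w. length w = k \<and> restr x m @ w = restr x (m + k)" for m k
    by (intro exI[of _ "drop m (restr x (m + k))"]) simp
  ultimately have "\<exists>w. length w = k \<and> restr x m @ w \<in> raw_tree (restr x n) (restr y n)" for m k
    by metis
  then have "restr x m \<in> cover_tree (restr x n) (restr y n)" for m
    unfolding cover_tree_def using late[of 0] unfolding u0 unfolding u_def by blast
  then show ?thesis unfolding body_def by blast
qed

end

section \<open>Definability of the cover\<close>

locale hurewicz_D11 = hurewicz +
  assumes D11_S: "\<And>a b. D11_list a \<Longrightarrow> D11_list b \<Longrightarrow> D11 (\<lambda>e. S (a e) (b e))"
    and D11_T: "\<And>a b. D11_list a \<Longrightarrow> D11_list b \<Longrightarrow> D11 (\<lambda>e. T (a e) (b e))"
begin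

lemma D11_num_P0 [D11_intros]: "D11_list s \<Longrightarrow> D11_list t \<Longrightarrow> D11_num (\<lambda>e. P0 (s e) (t e))"
  unfolding P0_def by (intro D11_intros)

lemma D11_num_P1 [D11_intros]: "D11_list s \<Longrightarrow> D11_list t \<Longrightarrow> D11_list r \<Longrightarrow> D11_num (\<lambda>e. P1 (s e) (t e) (r e))"
  unfolding P1_def by (intro D11_intros)

lemma D11_num_P2 [D11_intros]: "D11_list s \<Longrightarrow> D11_list t \<Longrightarrow> D11_list p \<Longrightarrow> D11_list q \<Longrightarrow> D11_num (\<lambda>e. P2 (s e) (t e) (p e) (q e))"
  unfolding P2_def by (intro D11_intros)

lemma D11_ext [D11_intros]:
  "D11_list s \<Longrightarrow> D11_list t \<Longrightarrow> D11_list s' \<Longrightarrow> D11_list t' \<Longrightarrow> D11 (\<lambda>e. ext (s e) (t e) (s' e) (t' e))"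
  unfolding ext_def by (intro D11_intros D11_S)

lemma D11_move [D11_intros]: "D11_num c \<Longrightarrow> D11_num i \<Longrightarrow> D11_num c' \<Longrightarrow> D11 (\<lambda>e. move (c e) (i e) (c' e))"
proof (rule D11_subst3[where P = "\<lambda>_. move"])
  show "D11 (\<lambda>e. move (hdN (tlN (tlN e))) (hdN (tlN e)) (hdN e))"
    unfolding move_def by (intro D11_intros D11_T)
qed

text \<open>A relation on positions is coded as a point of Baire space, with 0 for true, so that one
  function quantifier ranges over all candidates for the comparison.\<close>

definition coded_comparison :: "baire \<Rightarrow> bool" where
  "coded_comparison z \<longleftrightarrow> (\<forall>p q. z (prod_encode (p, q)) = 0 \<longleftrightarrow>
     (\<exists>i. \<forall>p'. move p i p' \<longrightarrow> (\<forall>i'. \<exists>q'. move q i' q' \<and> z (prod_encode (p', q')) = 0)))"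

definition coded_cover :: "baire \<Rightarrow> nat list \<Rightarrow> nat list \<Rightarrow> nat list \<Rightarrow> bool" where
  "coded_cover z s t r \<longleftrightarrow> z (prod_encode (P0 s t, P0 [] [])) = 0 \<and>
     (\<forall>n. \<exists>w. length w = n \<and> (\<exists>s' t'. ext s t s' t' \<and> z (prod_encode (P0 s t, P0 s' t')) = 0 \<and> prefix (r @ w) s'))"

lemma coded_comparison_ex: "\<exists>z. coded_comparison z"
proof
  have if_0: "(if b then 0 else 1) = (0 :: nat) \<longleftrightarrow> b" for b by simp
  show "coded_comparison (\<lambda>c. if no_later (fst (prod_decode c)) (snd (prod_decode c)) then 0 else 1)"
    unfolding coded_comparison_def prod_encode_inverse fst_conv snd_conv if_0
    by (rule comparison_no_later[unfolded comparison_def])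
qed

text \<open>Every comparison that matters involves a won position: the root in the first condition,
  and \<open>P0 s t\<close> in the others, once that condition has been met.\<close>

lemma coded_cover_iff:
  assumes "coded_comparison z" "won (P0 [] [])"
  shows "coded_cover z s t r \<longleftrightarrow> r \<in> cover_tree s t"
proof -
  let ?R = "\<lambda>p q. z (prod_encode (p, q)) = 0"
  have "comparison ?R"
    using assms(1) unfolding coded_comparison_def comparison_def .
  from comparison_unique[OF this] have R: "won p \<or> won q \<Longrightarrow> ?R p q \<longleftrightarrow> no_later p q" for p q .
  have root: "?R (P0 s t) (P0 [] []) \<longleftrightarrow> no_later (P0 s t) (P0 [] [])" using R assms(2) by blast
  show ?thesis
  proof (cases "no_later (P0 s t) (P0 [] [])")
    case True
    then have "won (P0 s t)" by (rule no_later_won)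
    then have "?R (P0 s t) q \<longleftrightarrow> no_later (P0 s t) q" for q using R by blast
    with root True show ?thesis
      unfolding coded_cover_def cover_tree_def raw_tree_def by simp
  next
    case False
    with root show ?thesis unfolding coded_cover_def cover_tree_def by simp
  qed
qed

definition cover_seq :: "nat \<Rightarrow> nat list set" where
  "cover_seq n = cover_tree (list_decode (fst (prod_decode n))) (list_decode (snd (prod_decode n)))"

text \<open>All comparisons give the same answer and one exists. So membership means that some
  comparison affirms it, and non-membership that some comparison denies it; both statements are
  \<open>\<Sigma>\<^sup>1\<^sub>1\<close>.\<close>

lemma D11_cover_seq:
  assumes "won (P0 [] [])"
  shows "D11 (\<lambda>e. list_decode (hdN e) \<in> cover_seq (hdN (tlN e)))"
proof -
  let ?P = "\<lambda>e z. coded_cover z (list_decode (fst (prod_decode (hdN (tlN e)))))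
      (list_decode (snd (prod_decode (hdN (tlN e))))) (list_decode (hdN e))"
  have D: "D11 (\<lambda>e. coded_comparison (hdF e))"
    unfolding coded_comparison_def by (intro D11_intros)
  have D': "D11 (\<lambda>e. ?P (tlF e) (hdF e))"
    unfolding coded_cover_def by (intro D11_intros)
  have "S11 (\<lambda>e. \<exists>z. coded_comparison z \<and> ?P e z)"
    by (intro S11_ex_fun S11_conj D11_S11 D D')
  moreover have "S11 (\<lambda>e. \<exists>z. coded_comparison z \<and> \<not> ?P e z)"
    by (intro S11_ex_fun S11_conj D11_S11 D D11_not D')
  moreover have "(\<exists>z. coded_comparison z \<and> ?P e z) \<longleftrightarrow> list_decode (hdN e) \<in> cover_seq (hdN (tlN e))"
    "(\<exists>z. coded_comparison z \<and> \<not> ?P e z) \<longleftrightarrow> \<not> list_decode (hdN e) \<in> cover_seq (hdN (tlN e))" for e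
    using coded_comparison_ex coded_cover_iff[OF _ assms] unfolding cover_seq_def by blast+
  ultimately show ?thesis unfolding D11_def by simp
qed

lemma cover_seq:
  assumes "won (P0 [] [])"
  shows "compact_tree (cover_seq n)" "body (cover_seq n) \<subseteq> A" "A = (\<Union>n. body (cover_seq n))"
    "delta11_point (set_seq_code cover_seq)" "delta11_point (set_code (cover_seq n))"
proof -
  show ct: "compact_tree (cover_seq n)" "body (cover_seq n) \<subseteq> A" for n
    unfolding cover_seq_def by (rule compact_cover_tree, rule body_cover_tree)
  have "x \<in> (\<Union>n. body (cover_seq n))" if x: "x \<in> A" for x
  proof -
    obtain s t where "x \<in> body (cover_tree s t)" using cover_tree_covers[OF assms x] by blast
    then have "x \<in> body (cover_seq (prod_encode (list_encode s, list_encode t)))"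
      by (simp add: cover_seq_def)
    then show ?thesis by blast
  qed
  with ct(2) show "A = (\<Union>n. body (cover_seq n))" by blast
  show "delta11_point (set_seq_code cover_seq)" "delta11_point (set_code (cover_seq n))"
    by (intro delta11_point_set_seq_code delta11_point_set_code D11_cover_seq assms)+
qed

end

text \<open>The point is approximated by \<open>s\<close> and the witness by \<open>t\<close>, while
  \<open>f\<close> reads the witness first. Independent lengths are absorbed by testing all pairs of
  prefixes. The tree is arithmetical, which is all that the game requires.\<close>

definition avoid_tree :: "recf \<Rightarrow> nat list \<Rightarrow> nat list \<Rightarrow> bool" where
  "avoid_tree f s t \<longleftrightarrow> length s = length t \<and>
     (\<forall>a b. prefix a t \<longrightarrow> prefix b s \<longrightarrow> [list_encode a, list_encode b] \<notin> re_domain f)"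

lemma D11_avoid_tree: "D11_list s \<Longrightarrow> D11_list t \<Longrightarrow> D11 (\<lambda>e. avoid_tree f (s e) (t e))"
  unfolding avoid_tree_def by (intro D11_intros D11_list_tlN)

lemma avoid_tree_length: "avoid_tree f s t \<Longrightarrow> length s = length t"
  by (simp add: avoid_tree_def)

lemma avoid_tree_take: "avoid_tree f s t \<Longrightarrow> avoid_tree f (take n s) (take n t)"
  unfolding avoid_tree_def by (auto intro: prefix_order.trans[OF _ take_is_prefix])

lemma avoid_tree_restr:
  "(\<forall>n. avoid_tree f (restr x n) (restr y n)) \<longleftrightarrow>
   (\<forall>m M. [list_encode (restr y m), list_encode (restr x M)] \<notin> re_domain f)"
proof
  assume L: "\<forall>n. avoid_tree f (restr x n) (restr y n)"
  show "\<forall>m M. [list_encode (restr y m), list_encode (restr x M)] \<notin> re_domain f"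
  proof (intro allI)
    fix m M
    from L have "avoid_tree f (restr x (max m M)) (restr y (max m M))" ..
    then show "[list_encode (restr y m), list_encode (restr x M)] \<notin> re_domain f"
      unfolding avoid_tree_def using prefix_restr[of m "max m M" y] prefix_restr[of M "max m M" x] by simp
  qed
next
  assume R: "\<forall>m M. [list_encode (restr y m), list_encode (restr x M)] \<notin> re_domain f"
  have "[list_encode a, list_encode b] \<notin> re_domain f" if "prefix a (restr y n)" "prefix b (restr x n)" for a b n
  proof -
    have "a = restr y (length a)" "b = restr x (length b)"
      using that[THEN ini_prefix[OF _ ini_restr]] unfolding ini_def by simp_all
    then show ?thesis using R by metis
  qed
  then show "\<forall>n. avoid_tree f (restr x n) (restr y n)"
    unfolding avoid_tree_def by simp
qed

theorem theorem2:
  fixes A :: "(nat \<Rightarrow> nat) set"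
  assumes "delta11_set A"
  defines "claim_I \<equiv>
      A = \<Union> {body T | T. compact_tree T \<and> delta11_point (set_code T) \<and> body T \<subseteq> A} \<and>
      (\<exists>Ts :: nat \<Rightarrow> nat list set. delta11_point (set_seq_code Ts) \<and>
         (\<forall>n. compact_tree (Ts n)) \<and> A = (\<Union>n. body (Ts n)))"
    and "claim_II \<equiv>
      (\<exists>Y. Y \<subseteq> A \<and> Y homeomorphic (UNIV :: (nat \<Rightarrow> nat) set) \<and> closedin (top_of_set A) Y)"
  shows "(claim_I \<or> claim_II) \<and> \<not> (claim_I \<and> claim_II)"
proof -
  obtain f where f: "\<And>x. x \<in> A \<longleftrightarrow> (\<exists>y. \<forall>m M. [list_encode (restr y m), list_encode (restr x M)] \<notin> re_domain f)"
    using assms(1) sigma11_0_1[of "\<lambda>_ xs. xs ! 0 \<in> A"]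
    unfolding delta11_set_def delta11_def by auto
  obtain g where g: "\<And>x. x \<notin> A \<longleftrightarrow> (\<exists>y. \<forall>m M. [list_encode (restr y m), list_encode (restr x M)] \<notin> re_domain g)"
    using assms(1) sigma11_0_1[of "\<lambda>_ xs. xs ! 0 \<notin> A"]
    unfolding delta11_set_def delta11_def pi11_def by auto
  interpret hurewicz_D11 "avoid_tree f" "avoid_tree g" A
  proof
    show "x \<in> A \<longleftrightarrow> (\<exists>y. \<forall>n. avoid_tree f (restr x n) (restr y n))"
      and "x \<notin> A \<longleftrightarrow> (\<exists>y. \<forall>n. avoid_tree g (restr x n) (restr y n))" for x
      unfolding avoid_tree_restr by (fact f, fact g)
  qed (auto intro: avoid_tree_take D11_avoid_tree dest: avoid_tree_length)
  have "claim_I \<or> claim_II"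
  proof (cases "won (P0 [] [])")
    case True
    note cover = cover_seq[OF True]
    have "A = \<Union> {body T | T. compact_tree T \<and> delta11_point (set_code T) \<and> body T \<subseteq> A}"
    proof
      show "A \<subseteq> \<Union> {body T | T. compact_tree T \<and> delta11_point (set_code T) \<and> body T \<subseteq> A}"
      proof
        fix x assume "x \<in> A"
        then obtain n where "x \<in> body (cover_seq n)" using cover(3) by blast
        with cover(1,2,5)[of n] show "x \<in> \<Union> {body T | T. compact_tree T \<and> delta11_point (set_code T) \<and> body T \<subseteq> A}"
          by blast
      qed
    qed blast
    with cover(1,3,4) have claim_I unfolding claim_I_def by blast
    then show ?thesis ..
  next
    case False
    with closed_copy_of_baire show ?thesis unfolding lost_def claim_II_def by blast
  qed
  moreover have "\<not> (claim_I \<and> claim_II)"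
  proof
    assume "claim_I \<and> claim_II"
    then obtain Ts Y where "\<And>n :: nat. compact_tree (Ts n)" "A = (\<Union>n. body (Ts n))"
      "Y homeomorphic (UNIV :: baire set)" "closedin (top_of_set A) Y"
      unfolding claim_I_def claim_II_def by blast
    then show False using not_sigma_compact_baire compact_body by metis
  qed
  ultimately show ?thesis ..
qed

end
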